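(* For $q\in\mathbb{C}$ with $|q|<1$, $$\sum_{i,j\ge0}\frac{q^{i^2-2ij+2j^2+i-j}}{(q;q)_{2i}(q;q)_{2j}}=\sum_{i,j\ge0}\frac{q^{i^2-2ij+2j^2+j}}{(q;q)_{2i}(q;q)_{2j+1}}=\frac{1}{(q;q^2)_\infty^2(q^{2},q^{3},q^{4},q^{10},q^{11},q^{12};q^{14})_\infty},$$ $$\sum_{i,j\ge0}\frac{q^{i^2-2ij+2j^2+i-j}}{(q;q)_{2i+1}(q;q)_{2j}}=\sum_{i,j\ge0}\frac{q^{i^2-2ij+2j^2+j}}{(q;q)_{2i+1}(q;q)_{2j+1}}=\frac{1}{(q;q^2)_\infty^2(q,q^{4},q^{6},q^{8},q^{10},q^{13};q^{14})_\infty},$$ $$\sum_{i,j\ge0}\frac{q^{i^2-2ij+2j^2+2i-j}}{(q;q)_{2i+1}(q;q)_{2j}}=\sum_{i,j\ge0}\frac{q^{i^2-2ij+2j^2+i+j}}{(q;q)_{2i+1}(q;q)_{2j+1}}=\frac{1}{(q;q^2)_\infty^2(q^{2},q^{5},q^{6},q^{8},q^{9},q^{12};q^{14})_\infty}.$$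
   Context: For $|q|<1$: $(a;q)_\infty=\prod_{k\ge0}(1-aq^k)$; for integers $n\ge0$, $(a;q)_n=\prod_{k=0}^{n-1}(1-aq^k)$; and $(a_1,\dots,a_m;q)_\infty=\prod_{k=1}^m(a_k;q)_\infty$. *)

theory Defs
  imports "HOL-Analysis.Analysis"
begin

definition qpoch :: "complex \<Rightarrow> complex \<Rightarrow> nat \<Rightarrow> complex" where
  "qpoch a q n = (\<Prod>k<n. 1 - a * q ^ k)"

text \<open>Only meaningful when the infinite product converges, e.g. for \<open>norm q < 1\<close>
  (lemma \<open>convergent_prod_qpoch_inf\<close> below).\<close>

definition qpoch_inf :: "complex \<Rightarrow> complex \<Rightarrow> complex" where
  "qpoch_inf a q = (\<Prod>k. 1 - a * q ^ k)"

definition qpoch_infs :: "complex list \<Rightarrow> complex \<Rightarrow> complex" where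
  "qpoch_infs as q = (\<Prod>a\<leftarrow>as. qpoch_inf a q)"

lemma convergent_prod_qpoch_inf:
  fixes a q :: complex
  assumes "norm q < 1"
  shows "convergent_prod (\<lambda>k. 1 - a * q ^ k)"
proof -
  have "summable (\<lambda>k. norm (1 - a * q ^ k - 1))"
    using assms by (simp add: norm_mult norm_power summable_mult summable_geometric)
  then show ?thesis
    by (intro abs_convergent_prod_imp_convergent_prod summable_imp_abs_convergent_prod)
qed

end

theory Submission
  imports Defs
begin

text \<open>Let \<open>q \<noteq> 0\<close> and write \<open>(a)\<^sub>n\<close> for \<open>(a;q)\<^sub>n\<close>. The sum over \<open>j\<close> is a parity part of Euler's
  expansion of the product \<open>(-q\<^sup>-\<^sup>i)\<^sub>\<infinity>\<close>. Its even and odd parts coincide because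
  \<open>(q\<^sup>-\<^sup>i)\<^sub>\<infinity> = 0\<close>, which explains why both double sums in each line agree, and reduces them to
  \<open>(-q)\<^sub>\<infinity>\<close> times single sums such as \<open>\<Sum>i. q\<^bsup>i(i+1)/2\<^esup> (-q)\<^sub>i / (q)\<^bsub>2i\<^esub>\<close>, Slater's identities 80, 81 and 82.
  By the \<open>q\<close>-Pascal rules, the factor \<open>1 / (q)\<^bsub>2i\<^esub>\<close> is a finite bilateral sum over \<open>k\<close> with
  summands \<open>\<plusminus>q\<^bsup>6k\<^sup>2+uk\<^esup> / ((q)\<^bsub>i-r\<^esub> (q)\<^bsub>i+r+1\<^esub>)\<close> where \<open>r\<close> is \<open>3k\<close> or \<open>3k+1\<close>. Summing over
  \<open>i\<close> first is possible in closed form (a \<open>1\<phi>1\<close> sum) and leaves a theta series, which the quintuple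
  product identity with base \<open>q\<^sup>7\<close> evaluates. That identity is a limit of a finite one, proved by
  telescoping.\<close>

section \<open>Shifted factorials and a basic hypergeometric sum\<close>

text \<open>The modulus 7 comes from adding exponents: 6k^2 in the finite theta sums plus r(r+1)/2
  with r = 3k, left over by the sum over i, has leading coefficient 21/2, which is 7 times the 3/2
  of the quintuple product series. The modulus 14 appears when the factors with x^2 and q/x^2 are
  split by parity. The square of (q;q^2)_inf stands for two factors (-q;q)_inf, one produced by each
  summation. The obstacle is analytic. The exponents contain -2ij and the \<open>has_sum\<close>
  statements are unordered, so every rearrangement needs absolute summability: the exponent of the
  double sum is bounded below by i + j - 1, the bilateral expansion lives on |k| at most n plus a
  constant, and the limit in the quintuple identity is taken under a uniform majorant. Negative
  powers of q occur throughout this route, so q = 0 is treated separately; there only the term i = j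
  = 0 survives.\<close>

lemma qpoch_0 [simp]: "qpoch a q 0 = 1"
  by (simp add: qpoch_def)

lemma qpoch_Suc: "qpoch a q (Suc n) = qpoch a q n * (1 - a * q ^ n)"
  by (simp add: qpoch_def)

lemma qpoch_add: "qpoch a q (m + n) = qpoch a q m * qpoch (a * q ^ m) q n"
  by (induction n) (simp_all add: qpoch_Suc power_add mult.assoc)

lemma qpoch_Suc_left: "qpoch a q (Suc n) = (1 - a) * qpoch (a * q) q n"
  using qpoch_add[of a q 1 n] by (simp add: qpoch_Suc)

lemma qpoch_eq_0_iff: "qpoch a q n = 0 \<longleftrightarrow> (\<exists>k<n. a * q ^ k = 1)"
  by (auto simp: qpoch_def)

lemma triangle_Suc: "Suc m * (Suc m - 1) div 2 = m * (m - 1) div 2 + m"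
proof (cases m)
  case (Suc k)
  have "Suc m * (Suc m - 1) = m * (m - 1) + m * 2"
    using Suc by simp
  then show ?thesis by simp
qed simp

text \<open>The ratio of consecutive terms is \<open>b * r ^ m\<close>, which tends to 0 however
  large \<open>b\<close> is.\<close>

lemma summable_theta_nat:
  fixes r :: real
  assumes "0 \<le> r" "r < 1" "0 \<le> b"
  shows "summable (\<lambda>m. b ^ m * r ^ (m * (m - 1) div 2))"
proof -
  have "(\<lambda>m. b * r ^ m) \<longlonglongrightarrow> b * 0"
    by (intro tendsto_mult tendsto_const LIMSEQ_realpow_zero assms)
  then have "\<forall>\<^sub>F m in sequentially. b * r ^ m < 1/2"
    by (intro order_tendstoD(2)) auto
  then obtain N where N: "\<And>m. m \<ge> N \<Longrightarrow> b * r ^ m < 1/2"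
    by (auto simp: eventually_sequentially)
  show ?thesis
  proof (rule summable_ratio_test[of "1/2" N])
    fix m assume "N \<le> m"
    have "norm (b ^ Suc m * r ^ (Suc m * (Suc m - 1) div 2))
        = (b * r ^ m) * norm (b ^ m * r ^ (m * (m - 1) div 2))"
      unfolding triangle_Suc using assms by (simp add: power_add abs_mult)
    also have "\<dots> \<le> 1/2 * norm (b ^ m * r ^ (m * (m - 1) div 2))"
      using N[OF \<open>N \<le> m\<close>] by (intro mult_right_mono) auto
    finally show "norm (b ^ Suc m * r ^ (Suc m * (Suc m - 1) div 2))
        \<le> 1/2 * norm (b ^ m * r ^ (m * (m - 1) div 2))" .
  qed simp
qed

text \<open>Summand of the series 1phi1(A; Ab; q, b). With \<open>b\<close> as the free variable
  instead of the lower parameter, A = 0 is a legitimate instance: it is Euler's expansion of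
  \<open>qpoch_inf b q\<close>.\<close>

definition phi_term :: "complex \<Rightarrow> complex \<Rightarrow> complex \<Rightarrow> nat \<Rightarrow> complex" where
  "phi_term q A b m = qpoch A q m * (- b) ^ m * q ^ (m * (m - 1) div 2)
     / (qpoch q q m * qpoch (A * b) q m)"

section \<open>Infinite products in the unit disc and the 1phi1 sum\<close>

context
  fixes q :: complex
  assumes q: "norm q < 1"
begin

lemma power_q_neq_1: "0 < k \<Longrightarrow> q ^ k \<noteq> 1"
proof
  assume "0 < k" "q ^ k = 1"
  then have "norm q ^ k = 1" by (metis norm_one norm_power)
  moreover have "norm q ^ k < 1"
    using \<open>0 < k\<close> q by (simp add: power_less_one_iff)
  ultimately show False by simp
qed

lemma qpoch_qq_nonzero: "qpoch q q n \<noteq> 0"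
  using power_q_neq_1[of "Suc _"] by (auto simp: qpoch_eq_0_iff)

lemma qpoch_tendsto: "qpoch a q \<longlonglongrightarrow> qpoch_inf a q"
proof (rule LIMSEQ_imp_Suc)
  show "(\<lambda>n. qpoch a q (Suc n)) \<longlonglongrightarrow> qpoch_inf a q"
    using convergent_prod_LIMSEQ[OF convergent_prod_qpoch_inf[OF q, of a]]
    by (simp add: qpoch_def qpoch_inf_def lessThan_Suc_atMost)
qed

lemma qpoch_inf_split: "qpoch_inf a q = qpoch a q n * qpoch_inf (a * q ^ n) q"
proof (rule LIMSEQ_unique)
  show "(\<lambda>m. qpoch a q (m + n)) \<longlonglongrightarrow> qpoch_inf a q"
    by (rule LIMSEQ_ignore_initial_segment[OF qpoch_tendsto])
  show "(\<lambda>m. qpoch a q (m + n)) \<longlonglongrightarrow> qpoch a q n * qpoch_inf (a * q ^ n) q"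
    by (subst add.commute, subst qpoch_add) (intro tendsto_intros qpoch_tendsto)
qed

lemma qpoch_inf_nonzero: "(\<And>k. a * q ^ k \<noteq> 1) \<Longrightarrow> qpoch_inf a q \<noteq> 0"
  unfolding qpoch_inf_def
  by (intro prodinf_nonzero convergent_prod_qpoch_inf q) auto

lemma qpoch_inf_eq_0: "a * q ^ k = 1 \<Longrightarrow> qpoch_inf a q = 0"
  using qpoch_inf_split[of a "Suc k"] by (simp add: qpoch_Suc)

lemma qpoch_inf_nonzero_norm_less: "norm a < 1 \<Longrightarrow> qpoch_inf a q \<noteq> 0"
proof (rule qpoch_inf_nonzero)
  fix k assume "norm a < 1"
  moreover have "norm (a * q ^ k) \<le> norm a * 1"
    unfolding norm_mult norm_power using q by (intro mult_left_mono power_le_one) auto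
  ultimately show "a * q ^ k \<noteq> 1" by auto
qed

lemma qpoch_bounded: "\<exists>C>0. \<forall>n. norm (qpoch a q n) \<le> C"
  using Bseq_def convergentI convergent_imp_Bseq qpoch_tendsto by metis

lemma inverse_qpoch_bounded:
  assumes "\<And>k. a * q ^ k \<noteq> 1"
  shows "\<exists>C>0. \<forall>n. norm (inverse (qpoch a q n)) \<le> C"
proof -
  have "(\<lambda>n. inverse (qpoch a q n)) \<longlonglongrightarrow> inverse (qpoch_inf a q)"
    by (intro tendsto_inverse qpoch_tendsto qpoch_inf_nonzero assms)
  then show ?thesis
    using Bseq_def convergentI convergent_imp_Bseq by metis
qed

text \<open>Exponents are sorted by residue modulo \<open>m\<close>. For partial products of length
  \<open>m * n\<close> this is an exact identity, and that subsequence determines the limit.\<close>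

lemma qpoch_inf_dissect:
  assumes "0 < m"
  shows "qpoch_inf a q = (\<Prod>s<m. qpoch_inf (a * q ^ s) (q ^ m))"
proof (rule LIMSEQ_unique)
  have qm: "norm (q ^ m) < 1"
    using q assms by (simp add: norm_power power_less_one_iff)
  have "qpoch a q (m * n) = (\<Prod>s<m. qpoch (a * q ^ s) (q ^ m) n)" for n
  proof (induction n)
    case (Suc n)
    have "qpoch a q (m * Suc n) = qpoch a q (m * n) * qpoch (a * q ^ (m * n)) q m"
      by (metis add.commute mult_Suc_right qpoch_add)
    also have "qpoch (a * q ^ (m * n)) q m = (\<Prod>s<m. 1 - a * q ^ s * (q ^ m) ^ n)"
      by (simp add: qpoch_def power_mult mult_ac)
    finally show ?case by (simp add: Suc qpoch_Suc prod.distrib)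
  qed simp
  moreover have "(\<lambda>n. \<Prod>s<m. qpoch (a * q ^ s) (q ^ m) n)
      \<longlonglongrightarrow> (\<Prod>s<m. qpoch_inf (a * q ^ s) (q ^ m))"
    by (intro tendsto_prod, rule LIMSEQ_imp_Suc, rule LIMSEQ_Suc)
       (use convergent_prod_LIMSEQ[OF convergent_prod_qpoch_inf[OF qm]] in
         \<open>auto simp: qpoch_def qpoch_inf_def lessThan_Suc_atMost
            intro!: LIMSEQ_imp_Suc[of "\<lambda>n. prod _ {..<n}"]\<close>)
  ultimately show "(\<lambda>n. qpoch a q (m * n)) \<longlonglongrightarrow> (\<Prod>s<m. qpoch_inf (a * q ^ s) (q ^ m))"
    by simp
  show "(\<lambda>n. qpoch a q (m * n)) \<longlonglongrightarrow> qpoch_inf a q"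
    using LIMSEQ_subseq_LIMSEQ[OF qpoch_tendsto[of a], of "\<lambda>n. m * n"] assms
    by (simp add: o_def strict_mono_def)
qed

text \<open>The constant is uniform in the shift \<open>n\<close>: the moving factor 1/(A b q^n)_m
  is rewritten as (Ab)_n / (Ab)_(n+m), whose two parts are bounded separately. The factor
  \<open>norm (q ^ n) ^ m\<close> is kept because it makes all terms with m > 0 disappear as n
  grows.\<close>

lemma phi_term_bound:
  assumes "\<And>k. A * b * q ^ k \<noteq> 1"
  obtains C where "0 < C" "\<And>m n. norm (phi_term q A (b * q ^ n) m)
    \<le> C * norm (q ^ n) ^ m * (norm b ^ m * norm q ^ (m * (m - 1) div 2))"
proof -
  obtain C1 where C1: "C1 > 0" "\<And>n. norm (qpoch A q n) \<le> C1"
    using qpoch_bounded by blast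
  obtain C2 where C2: "C2 > 0" "\<And>n. norm (inverse (qpoch q q n)) \<le> C2"
    using inverse_qpoch_bounded[of q] power_q_neq_1[of "Suc _"] by auto
  obtain C3 where C3: "C3 > 0" "\<And>n. norm (inverse (qpoch (A * b) q n)) \<le> C3"
    using inverse_qpoch_bounded[of "A * b"] assms by blast
  obtain C4 where C4: "C4 > 0" "\<And>n. norm (qpoch (A * b) q n) \<le> C4"
    using qpoch_bounded by blast
  have nz: "qpoch (A * b) q n \<noteq> 0" for n
    using assms by (auto simp: qpoch_eq_0_iff)
  show ?thesis
  proof (rule that[of "C1 * C2 * (C4 * C3)"])
    fix m n
    have "inverse (qpoch (A * (b * q ^ n)) q m) =
        qpoch (A * b) q n * inverse (qpoch (A * b) q (n + m))"
      using nz[of n] by (simp add: qpoch_add mult.assoc)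
    then have "norm (phi_term q A (b * q ^ n) m) =
       norm (qpoch A q m) * norm (inverse (qpoch q q m)) *
       (norm (qpoch (A * b) q n) * norm (inverse (qpoch (A * b) q (n + m)))) *
       (norm (q ^ n) ^ m * (norm b ^ m * norm q ^ (m * (m - 1) div 2)))"
      by (simp add: phi_term_def divide_inverse norm_mult norm_power power_mult_distrib mult_ac)
    also have "\<dots> \<le> C1 * C2 * (C4 * C3) * (norm (q ^ n) ^ m * (norm b ^ m * norm q ^ (m * (m -
        1) div 2)))"
      using C1 C2 C3 C4 by (intro mult_mono) (auto intro!: mult_nonneg_nonneg less_imp_le)
    finally show "norm (phi_term q A (b * q ^ n) m)
        \<le> C1 * C2 * (C4 * C3) * norm (q ^ n) ^ m * (norm b ^ m * norm q ^ (m * (m - 1) div 2))"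
      by (simp add: mult.assoc)
  qed (use C1 C2 C3 C4 in simp)
qed

lemma phi_term_summable:
  assumes "\<And>k. A * b * q ^ k \<noteq> 1"
  shows "summable (\<lambda>m. norm (phi_term q A b m))"
proof -
  obtain C where C: "\<And>m n. norm (phi_term q A (b * q ^ n) m)
    \<le> C * norm (q ^ n) ^ m * (norm b ^ m * norm q ^ (m * (m - 1) div 2))"
    using phi_term_bound[OF assms] by metis
  have "summable (\<lambda>m. C * (norm b ^ m * norm q ^ (m * (m - 1) div 2)))"
    using q by (intro summable_mult summable_theta_nat) auto
  then show ?thesis
    by (rule summable_comparison_test') (use C[of 0] in auto)
qed

text \<open>The difference of the two series telescopes with \<open>g\<close>. No boundary term
  remains, since the factor 1 - q^m vanishes at m = 0 and the summands tend to 0.\<close>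

lemma phi_sum_step:
  assumes nz: "\<And>k. A * b * q ^ k \<noteq> 1"
  shows "suminf (phi_term q A b) = (1 - b) / (1 - A * b) * suminf (phi_term q A (b * q))"
proof -
  define g where "g m = phi_term q A b m * (1 - q ^ m)" for m
  have nz': "A * (b * q) * q ^ k \<noteq> 1" for k
    using nz[of "Suc k"] by (simp add: mult_ac)
  have s: "summable (phi_term q A b)" "summable (phi_term q A (b * q))"
    using phi_term_summable[of A b, THEN summable_norm_cancel] 
      phi_term_summable[of A "b * q", THEN summable_norm_cancel] nz nz' by auto
  have "g \<longlonglongrightarrow> 0 * (1 - 0)"
    unfolding g_def using q
    by (intro tendsto_intros summable_LIMSEQ_zero s LIMSEQ_power_zero)
  then have "(\<lambda>m. g m - g (Suc m)) sums (g 0 - 0)"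
    by (intro telescope_sums') simp
  moreover have "g m - g (Suc m) = phi_term q A b m - (1 - b) /
      (1 - A * b) * phi_term q A (b * q) m" for m
  proof -
    \<comment> \<open>With \<open>D\<close> as common factor of the three terms involved, the
      telescoping relation is a polynomial identity in A, b and q^m.\<close>
    define D where "D = qpoch A q m * (- b) ^ m * q ^ (m * (m - 1) div 2)
      / (qpoch q q m * qpoch (A * b) q (Suc m))"
    have nn: "1 - A * b * q ^ m \<noteq> 0" "1 - A * b \<noteq> 0" "qpoch (A * b) q m \<noteq> 0"
      "qpoch (A * (b * q)) q m \<noteq> 0" "qpoch q q m \<noteq> 0" "1 - q * q ^ m \<noteq> 0"
      using nz[of m] nz[of 0] nz nz' qpoch_qq_nonzero power_q_neq_1[of "Suc m"]
      by (auto simp: qpoch_eq_0_iff)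
    have 1: "phi_term q A b m = D * (1 - A * b * q ^ m)"
      using nn by (simp add: phi_term_def D_def qpoch_Suc)
    have "(1 - A * b) * qpoch (A * (b * q)) q m = qpoch (A * b) q (Suc m)"
      by (simp add: qpoch_Suc_left mult_ac)
    then have 2: "phi_term q A (b * q) m / (1 - A * b) = D * q ^ m"
      using power_mult_distrib[of "- b" q m] by (simp add: phi_term_def D_def mult_ac)
    have 3: "phi_term q A b (Suc m) * (1 - q ^ Suc m) = D * (- b * q ^ m) * (1 - A * q ^ m)"
      using nn(6) unfolding phi_term_def D_def triangle_Suc qpoch_Suc[of A] qpoch_Suc[of q] power_add power_Suc
      by (simp add: mult_ac)
    have "g m - g (Suc m) = D * ((1 - A * b * q ^ m) * (1 - q ^ m) + b * q ^ m * (1 - A * q ^ m))"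
      unfolding g_def 3 1 by (simp add: algebra_simps)
    also have "\<dots> = D * (1 - A * b * q ^ m) - (1 - b) * (D * q ^ m)"
      by (simp add: algebra_simps)
    finally show ?thesis
      unfolding 1 2[symmetric] by simp
  qed
  ultimately have "(\<lambda>m. phi_term q A b m - (1 - b) / (1 - A * b) * phi_term q A (b * q) m) sums 0"
    by (simp add: g_def)
  moreover have "(\<lambda>m. phi_term q A b m - (1 - b) / (1 - A * b) * phi_term q A (b * q) m) sums
     (suminf (phi_term q A b) - (1 - b) / (1 - A * b) * suminf (phi_term q A (b * q)))"
    by (intro sums_diff sums_mult summable_sums s)
  ultimately show ?thesis
    using sums_unique2 by force
qed

text \<open>Iterating \<open>phi_sum_step\<close> pushes \<open>b\<close> to
  \<open>b * q ^ n\<close>, where the series tends to its constant term 1, while the accumulated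
  factors are partial products of the two infinite products.\<close>

theorem phi_has_sum:
  assumes nz: "\<And>k. A * b * q ^ k \<noteq> 1"
  shows "(phi_term q A b has_sum qpoch_inf b q / qpoch_inf (A * b) q) UNIV"
proof -
  have nz': "A * (b * q ^ n) * q ^ k \<noteq> 1" for n k
    using nz[of "n + k"] by (simp add: power_add mult_ac)
  have iter: "suminf (phi_term q A b) = qpoch b q n /
      qpoch (A * b) q n * suminf (phi_term q A (b * q ^ n))" for n
  proof (induction n)
    case (Suc n)
    show ?case
      unfolding Suc phi_sum_step[of A "b * q ^ n", OF nz'] by (simp add: qpoch_Suc mult_ac)
  qed simp
  obtain C where C: "C > 0" "\<And>m n. norm (phi_term q A (b * q ^ n) m)
    \<le> C * norm (q ^ n) ^ m * (norm b ^ m * norm q ^ (m * (m - 1) div 2))"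
    using phi_term_bound[OF nz] by metis
  define h where "h m = norm b ^ m * norm q ^ (m * (m - 1) div 2)" for m
  have h: "summable h"
    unfolding h_def using q by (intro summable_theta_nat) auto
  have bnd: "norm (suminf (phi_term q A (b * q ^ n)) - 1) \<le> norm q ^ n * (C * suminf h)" for n
  proof -
    have s: "summable (phi_term q A (b * q ^ n))"
      using phi_term_summable[OF nz'] by (rule summable_norm_cancel)
    have "(\<lambda>m. phi_term q A (b * q ^ n) m - (if m =
        0 then 1 else 0)) sums (suminf (phi_term q A (b * q ^ n)) - 1)"
      by (intro sums_diff summable_sums s) (use sums_single[of 0 "\<lambda>_. 1 :: complex"] in auto)
    moreover have "norm (phi_term q A (b * q ^ n) m - (if m =
        0 then 1 else 0)) \<le> norm q ^ n * (C * h m)" for m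
    proof (cases m)
      case 0
      then show ?thesis using C by (simp add: phi_term_def h_def)
    next
      case (Suc k)
      have "norm (q ^ n) ^ m \<le> norm (q ^ n) ^ 1"
        unfolding norm_power using q Suc
        by (intro power_decreasing power_le_one) auto
      then have "C * norm (q ^ n) ^ m * h m \<le> C * norm q ^ n * h m"
        using C(1) by (intro mult_right_mono mult_left_mono) (auto simp: norm_power h_def)
      then show ?thesis
        using C(2)[of n m] Suc by (simp add: h_def mult_ac)
    qed
    moreover have "summable (\<lambda>m. norm q ^ n * (C * h m))"
      by (intro summable_mult h)
    ultimately have "norm (suminf (phi_term q A (b * q ^ n)) - 1) \<le> (\<Sum>m. norm q ^ n * (C * h m))"
      by (metis (no_types, lifting) norm_suminf_le sums_unique)
    then show ?thesis
      using h by (simp add: suminf_mult summable_mult)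
  qed
  have "(\<lambda>n. norm q ^ n * (C * suminf h)) \<longlonglongrightarrow> 0 * (C * suminf h)"
    using q by (intro tendsto_intros LIMSEQ_realpow_zero) auto
  then have "(\<lambda>n. suminf (phi_term q A (b * q ^ n)) - 1) \<longlonglongrightarrow> 0"
    by (intro Lim_null_comparison[OF always_eventually[OF allI[OF bnd]]]) simp
  then have "(\<lambda>n. suminf (phi_term q A (b * q ^ n))) \<longlonglongrightarrow> 1"
    by (simp add: LIM_zero_iff)
  then have "(\<lambda>n. qpoch b q n / qpoch (A * b) q n * suminf (phi_term q A (b * q ^ n)))
      \<longlonglongrightarrow> qpoch_inf b q / qpoch_inf (A * b) q * 1"
    by (intro tendsto_intros qpoch_tendsto qpoch_inf_nonzero nz)
  then have "suminf (phi_term q A b) = qpoch_inf b q / qpoch_inf (A * b) q"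
    using iter LIMSEQ_unique by (metis (no_types, lifting) LIMSEQ_const_iff ext mult.right_neutral)
  moreover have "(phi_term q A b has_sum suminf (phi_term q A b)) UNIV"
    using phi_term_summable[OF nz] norm_summable_imp_has_sum summable_norm_cancel summable_sums by blast
  ultimately show ?thesis by simp
qed

end

section \<open>Finite theta sums\<close>

lemma summable_on_int_geometric:
  fixes r :: real
  assumes "0 \<le> r" "r < 1"
  shows "(\<lambda>k::int. r ^ nat \<bar>k\<bar>) summable_on UNIV"
proof -
  have g: "(\<lambda>n. r ^ n) summable_on (UNIV :: nat set)"
    using assms by (intro summable_nonneg_imp_summable_on summable_geometric) auto
  have 1: "(\<lambda>k::int. r ^ nat \<bar>k\<bar>) summable_on {0..}"
    using g by (subst summable_on_reindex_bij_witness[of _ int nat UNIV "\<lambda>n. r ^ n"]) auto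
  have 2: "(\<lambda>k::int. r ^ nat \<bar>k\<bar>) summable_on {..0}"
    using g by (subst summable_on_reindex_bij_witness[of _ "\<lambda>n. -
        int n" "\<lambda>k. nat (- k)" UNIV "\<lambda>n. r ^ n"]) auto
  have "UNIV = {0::int..} \<union> {..0}" by auto
  then show ?thesis
    using summable_on_union[OF 1 2] by simp
qed

lemma summable_on_times:
  fixes f :: "'a \<Rightarrow> real" and g :: "'b \<Rightarrow> real"
  assumes "f summable_on A" "g summable_on B" "\<And>x. 0 \<le> f x" "\<And>y. 0 \<le> g y"
  shows "(\<lambda>(x, y). f x * g y) summable_on A \<times> B"
proof (rule summable_on_SigmaI)
  show "((\<lambda>y. case (x, y) of (x, y) \<Rightarrow> f x * g y) has_sum f x * infsum g B) B" for x
    using has_sum_cmult_right[OF has_sum_infsum[OF assms(2)], of "f x"] by simp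
  show "(\<lambda>x. f x * infsum g B) summable_on A"
    by (intro summable_on_cmult_left assms)
qed (use assms in auto)

lemma has_sum_diff:
  fixes f g :: "'a \<Rightarrow> 'b::real_normed_vector"
  assumes "(f has_sum a) A" "(g has_sum b) A"
  shows "((\<lambda>x. f x - g x) has_sum a - b) A"
proof -
  have "((\<lambda>x. - g x) has_sum - b) A"
    unfolding has_sum_uminus using assms(2) by simp
  from has_sum_add[OF assms(1) this] show ?thesis by simp
qed

text \<open>The value 0 at negative arguments is the usual convention for 1/(q)_m. It makes the
  recurrence from m to m - 1 hold at every integer (at m = 0 the factor 1 - q^0 vanishes), so the
  q-Pascal rules below have no boundary cases.\<close>

definition inv_qpoch :: "complex \<Rightarrow> int \<Rightarrow> complex" where
  "inv_qpoch q m = (if m < 0 then 0 else 1 / qpoch q q (nat m))"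

lemma inv_qpoch_neg [simp]: "m < 0 \<Longrightarrow> inv_qpoch q m = 0"
  by (simp add: inv_qpoch_def)

lemma inv_qpoch_int [simp]: "inv_qpoch q (int n) = 1 / qpoch q q n"
  by (simp add: inv_qpoch_def)

text \<open>The variable \<open>k\<close> runs over all integers, but the factors \<open>inv_qpoch\<close> leave only finitely
  many nonzero terms.\<close>

definition theta_fin :: "complex \<Rightarrow> int \<Rightarrow> int \<Rightarrow> int \<Rightarrow> complex" where
  "theta_fin q u a b =
     (\<Sum>\<^sub>\<infinity>k. q powi (6 * k\<^sup>2 + u * k) * inv_qpoch q (a - 3 * k) * inv_qpoch q (b + 3 * k))"

lemma summable_inv_qpoch_pair:
  "(\<lambda>k. f k * inv_qpoch q (a - 3 * k) * inv_qpoch q (b + 3 * k)) summable_on (UNIV :: int set)"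
proof (rule finite_nonzero_values_imp_summable_on, rule finite_subset)
  show "{k \<in> UNIV. f k * inv_qpoch q (a - 3 * k) * inv_qpoch q (b + 3 * k) \<noteq> 0} \<subseteq> {-\<bar>b\<bar>..\<bar>a\<bar>}"
    by (auto simp: inv_qpoch_def split: if_splits)
qed simp

context
  fixes q :: complex
  assumes q: "norm q < 1" and q0: "q \<noteq> 0"
begin

lemma inv_qpoch_minus_1: "inv_qpoch q (m - 1) = (1 - q powi m) * inv_qpoch q m"
proof (cases "m \<le> 0")
  case False
  then obtain n where "m = int (Suc n)"
    by (metis gr0_conv_Suc linorder_not_less nonneg_int_cases of_nat_0_less_iff order_less_imp_le)
  moreover have "q ^ Suc n \<noteq> 1"
    using power_q_neq_1[OF q, of "Suc n"] by simp
  ultimately show ?thesis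
    using qpoch_qq_nonzero[OF q]
    by (simp add: qpoch_Suc inv_qpoch_def nat_add_distrib power_int_add q0 mult_ac)
qed (auto simp: inv_qpoch_def)

lemma theta_fin_has_sum:
  "((\<lambda>k. q powi (6 * k\<^sup>2 + u * k) * inv_qpoch q (a - 3 * k) * inv_qpoch q (b + 3 * k))
      has_sum theta_fin q u a b) UNIV"
  unfolding theta_fin_def by (intro has_sum_infsum summable_inv_qpoch_pair)

lemma theta_fin_reflect: "theta_fin q u a b = theta_fin q (- u) b a"
  unfolding theta_fin_def
  by (rule infsum_reindex_bij_witness[of _ uminus uminus]) (auto simp: mult_ac)

text \<open>Substitution k -> -k - 1. With k -> -k it supplies the symmetries by which the leftover
  sums of different Pascal steps are matched.\<close>

lemma theta_fin_shift: "theta_fin q u a b = q powi (6 - u) * theta_fin q (12 - u) (b - 3) (a + 3)"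
proof -
  have "theta_fin q u a b = (\<Sum>\<^sub>\<infinity>k. q powi (6 - u) *
     (q powi (6 * k\<^sup>2 + (12 - u) * k) * inv_qpoch q (b - 3 - 3 * k) * inv_qpoch q (a + 3 + 3 * k)))"
    unfolding theta_fin_def
  proof (rule infsum_reindex_bij_witness[of _ "\<lambda>k. - k - 1" "\<lambda>k. - k - 1"])
    fix k :: int
    have "6 - u + (6 * (- k - 1)\<^sup>2 + (12 - u) * (- k - 1)) = 6 * k\<^sup>2 + u * k"
      by (simp add: power2_eq_square algebra_simps)
    then have "q powi (6 - u) * q powi (6 * (- k - 1)\<^sup>2 + (12 - u) * (- k - 1)) =
        q powi (6 * k\<^sup>2 + u * k)"
      by (metis power_int_add q0)
    then show "q powi (6 - u) * (q powi (6 * (- k - 1)\<^sup>2 + (12 - u) * (- k - 1)) *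
         inv_qpoch q (b - 3 - 3 * (- k - 1)) * inv_qpoch q (a + 3 + 3 * (- k - 1))) =
         q powi (6 * k\<^sup>2 + u * k) * inv_qpoch q (a - 3 * k) * inv_qpoch q (b + 3 * k)"
      by (simp add: algebra_simps)
  qed auto
  then show ?thesis
    by (simp add: theta_fin_def infsum_cmult_right' mult.assoc)
qed

lemma theta_fin_lower_right: "theta_fin q u a (b - 1) =
    theta_fin q u a b - q powi b * theta_fin q (u + 3) a b"
proof -
  have "((\<lambda>k. q powi (6 * k\<^sup>2 + u * k) * inv_qpoch q (a - 3 * k) * inv_qpoch q (b + 3 * k) -
       q powi b * (q powi (6 * k\<^sup>2 + (u + 3) * k) * inv_qpoch q (a -
           3 * k) * inv_qpoch q (b + 3 * k)))
       has_sum theta_fin q u a b - q powi b * theta_fin q (u + 3) a b) UNIV"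
    by (intro has_sum_diff has_sum_cmult_right theta_fin_has_sum)
  also have "(\<lambda>k. q powi (6 * k\<^sup>2 + u * k) * inv_qpoch q (a - 3 * k) * inv_qpoch q (b + 3 * k) -
       q powi b * (q powi (6 * k\<^sup>2 + (u + 3) * k) * inv_qpoch q (a -
           3 * k) * inv_qpoch q (b + 3 * k))) =
     (\<lambda>k. q powi (6 * k\<^sup>2 + u * k) * inv_qpoch q (a - 3 * k) * inv_qpoch q (b - 1 + 3 * k))"
  proof
    fix k
    have "inv_qpoch q (b - 1 + 3 * k) = (1 - q powi (b + 3 * k)) * inv_qpoch q (b + 3 * k)"
      using inv_qpoch_minus_1[of "b + 3 * k"] by (simp add: algebra_simps)
    moreover have "q powi b * q powi (6 * k\<^sup>2 + (u + 3) * k) =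
        q powi (6 * k\<^sup>2 + u * k) * q powi (b + 3 * k)"
    proof -
      have "b + (6 * k\<^sup>2 + (u + 3) * k) = 6 * k\<^sup>2 + u * k + (b + 3 * k)"
        by (simp add: algebra_simps)
      then show ?thesis by (metis power_int_add q0)
    qed
    ultimately show "q powi (6 * k\<^sup>2 + u * k) * inv_qpoch q (a - 3 * k) * inv_qpoch q (b + 3 * k) -
       q powi b * (q powi (6 * k\<^sup>2 + (u + 3) * k) * inv_qpoch q (a -
           3 * k) * inv_qpoch q (b + 3 * k)) =
       q powi (6 * k\<^sup>2 + u * k) * inv_qpoch q (a - 3 * k) * inv_qpoch q (b - 1 + 3 * k)"
      by (simp only: mult.assoc[symmetric]) (simp only: mult_ac ring_distribs mult_1_left)
  qed
  finally show ?thesis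
    using theta_fin_has_sum has_sum_unique by blast
qed

lemma theta_fin_lower_left: "theta_fin q u (a - 1) b =
    theta_fin q u a b - q powi a * theta_fin q (u - 3) a b"
proof -
  have "theta_fin q u (a - 1) b = theta_fin q (- u) b (a - 1)"
    by (rule theta_fin_reflect)
  also have "\<dots> = theta_fin q (- u) b a - q powi a * theta_fin q (- (u - 3)) b a"
    using theta_fin_lower_right[of "- u" b a] by simp
  also have "\<dots> = theta_fin q u a b - q powi a * theta_fin q (u - 3) a b"
    by (simp only: theta_fin_reflect[of u a b] theta_fin_reflect[of "u - 3" a b])
  finally show ?thesis .
qed

text \<open>Termwise this is 1 - q^(a+b) = (1 - q^(b+3k)) + q^(b+3k) (1 - q^(a-3k)); the factor
  q^(3k) is what raises \<open>u\<close> by 3.\<close>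

lemma theta_fin_Pascal_right:
  "(1 - q powi (a + b)) * theta_fin q u a b =
      theta_fin q u a (b - 1) + q powi b * theta_fin q (u + 3) (a - 1) b"
proof -
  have 1: "q powi (a + b) = q powi a * q powi b"
    by (simp add: power_int_add q0)
  have 2: "theta_fin q (u + 3) (a - 1) b = theta_fin q (u + 3) a b - q powi a * theta_fin q u a b"
    using theta_fin_lower_left[of "u + 3" a b] by simp
  show ?thesis
    unfolding 1 2 theta_fin_lower_right[of u a b] by (simp add: algebra_simps)
qed

lemma theta_fin_Pascal_left:
  "(1 - q powi (a + b)) * theta_fin q u a b =
      theta_fin q u (a - 1) b + q powi a * theta_fin q (u - 3) a (b - 1)"
proof -
  have 1: "q powi (a + b) = q powi a * q powi b"
    by (simp add: power_int_add q0)
  have 2: "theta_fin q (u - 3) a (b - 1) = theta_fin q (u - 3) a b - q powi b * theta_fin q u a b"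
    using theta_fin_lower_right[of "u - 3" a b] by simp
  show ?thesis
    unfolding 1 2 theta_fin_lower_left[of u a b] by (simp add: algebra_simps)
qed

lemma theta_fin_4_8: "theta_fin q 4 (n - 1) (n + 1) = q\<^sup>2 * theta_fin q 8 (n - 2) (n + 2)"
  using theta_fin_shift[of 4 "n - 1" "n + 1"] by (simp add: algebra_simps)

lemma powi_not_1: "0 < m \<Longrightarrow> q powi m \<noteq> 1"
  using power_q_neq_1[OF q, of "nat m"] by (simp add: power_int_def)

text \<open>Each Pascal step leaves an extra sum, with parameters 4 and 8. By
  \<open>theta_fin_4_8\<close> they are proportional and cancel, so the difference obeys the
  recurrence of the reciprocal factorial.\<close>

lemma theta_fin_odd_step:
  assumes E: "theta_fin q 1 n n - q * theta_fin q 5 (n - 1) (n + 1) =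
      inv_qpoch q (2 * n)" and n: "0 \<le> n"
  shows "theta_fin q 1 n (n + 1) - q * theta_fin q 5 (n - 1) (n + 2) = inv_qpoch q (2 * n + 1)"
proof -
  have 1: "(1 - q powi (2 * n + 1)) * theta_fin q 1 n (n + 1) =
      theta_fin q 1 n n + q powi (n + 1) * theta_fin q 4 (n - 1) (n + 1)"
    using theta_fin_Pascal_right[of n "n + 1" 1] by (simp add: algebra_simps)
  have 2: "(1 - q powi (2 * n + 1)) * theta_fin q 5 (n - 1) (n + 2) =
      theta_fin q 5 (n - 1) (n + 1) + q powi (n + 2) * theta_fin q 8 (n - 2) (n + 2)"
    using theta_fin_Pascal_right[of "n - 1" "n + 2" 5] by (simp add: algebra_simps)
  have 3: "q * q powi (n + 2) = q powi (n + 1) * q\<^sup>2"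
    using q0 by (simp add: power_int_add power2_eq_square)
  have "(1 - q powi (2 * n + 1)) * (theta_fin q 1 n (n + 1) - q * theta_fin q 5 (n - 1) (n + 2)) =
     (1 - q powi (2 * n + 1)) * theta_fin q 1 n (n + 1) - q * ((1 -
         q powi (2 * n + 1)) * theta_fin q 5 (n - 1) (n + 2))"
    by (simp add: algebra_simps)
  also have "\<dots> = theta_fin q 1 n n - q * theta_fin q 5 (n - 1) (n + 1)
      + (q powi (n + 1) * q\<^sup>2 - q * q powi (n + 2)) * theta_fin q 8 (n - 2) (n + 2)"
    unfolding 1 2 theta_fin_4_8 by (simp add: algebra_simps)
  also have "\<dots> = inv_qpoch q (2 * n)"
    unfolding 3 E by simp
  also have "\<dots> = (1 - q powi (2 * n + 1)) * inv_qpoch q (2 * n + 1)"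
    using inv_qpoch_minus_1[of "2 * n + 1"] by simp
  finally show ?thesis
    using powi_not_1[of "2 * n + 1"] n by simp
qed

text \<open>Now the left rule is applied; both leftovers are multiples of
  \<open>theta_fin q 2 n (n + 1)\<close>, the first one after reflecting u = -2, and their
  coefficients q^(n+1) and q * q^n agree.\<close>

lemma theta_fin_even_step:
  assumes E: "theta_fin q 1 n (n + 1) - q * theta_fin q 5 (n - 1) (n + 2) =
      inv_qpoch q (2 * n + 1)" and n: "0 \<le> n"
  shows "theta_fin q 1 (n + 1) (n + 1) - q * theta_fin q 5 n (n + 2) = inv_qpoch q (2 * n + 2)"
proof -
  have 1: "(1 - q powi (2 * n + 2)) * theta_fin q 1 (n + 1) (n + 1) =
      theta_fin q 1 n (n + 1) + q powi (n + 1) * theta_fin q 2 n (n + 1)"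
    using theta_fin_Pascal_left[of "n + 1" "n + 1" 1] theta_fin_reflect[of "- 2" "n + 1" n]
    by (simp add: algebra_simps)
  have 2: "(1 - q powi (2 * n + 2)) * theta_fin q 5 n (n + 2) =
      theta_fin q 5 (n - 1) (n + 2) + q powi n * theta_fin q 2 n (n + 1)"
    using theta_fin_Pascal_left[of n "n + 2" 5] by (simp add: algebra_simps)
  have "(1 - q powi (2 * n + 2)) * (theta_fin q 1 (n + 1) (n + 1) - q * theta_fin q 5 n (n + 2)) =
     (1 - q powi (2 * n + 2)) * theta_fin q 1 (n + 1) (n + 1) - q * ((1 -
         q powi (2 * n + 2)) * theta_fin q 5 n (n + 2))"
    by (simp add: algebra_simps)
  also have "\<dots> = inv_qpoch q (2 * n + 1)"
    unfolding 1 2 E[symmetric] by (simp add: power_int_add q0 algebra_simps)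
  also have "\<dots> = (1 - q powi (2 * n + 2)) * inv_qpoch q (2 * n + 2)"
    using inv_qpoch_minus_1[of "2 * n + 2"] by (simp add: add.commute)
  finally show ?thesis
    using powi_not_1[of "2 * n + 2"] n by simp
qed

lemma theta_fin_even: "theta_fin q 1 (int n) (int n) - q * theta_fin q 5 (int n -
    1) (int n + 1) = inv_qpoch q (2 * int n)"
proof (induction n)
  case 0
  have "((\<lambda>k. q powi (6 * k\<^sup>2 + 1 * k) * inv_qpoch q (0 - 3 * k) * inv_qpoch q (0 + 3 * k))
      has_sum 1) UNIV"
    by (rule has_sum_finite_neutralI[of "{0}"]) (auto simp: inv_qpoch_def)
  then have "theta_fin q 1 0 0 = 1"
    using theta_fin_has_sum has_sum_unique by blast
  \<comment> \<open>Two nonnegative indices would force 3k = -1.\<close>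
  moreover have "inv_qpoch q (- 1 - 3 * k) * inv_qpoch q (1 + 3 * k) = 0" for k
    by (cases "0 \<le> k") auto
  then have "((\<lambda>k. q powi (6 * k\<^sup>2 + 5 * k) * inv_qpoch q (- 1 -
      3 * k) * inv_qpoch q (1 + 3 * k)) has_sum 0) UNIV"
    by (intro has_sum_0) (simp add: mult.assoc)
  then have "theta_fin q 5 (- 1) 1 = 0"
    using theta_fin_has_sum has_sum_unique by blast
  ultimately show ?case by (simp add: inv_qpoch_def)
next
  case (Suc n)
  from theta_fin_even_step[OF theta_fin_odd_step[OF Suc]] show ?case
    by (simp add: algebra_simps)
qed

text \<open>In the language of Bailey pairs relative to \<open>a = q\<close>, the next three identities give
  \<open>\<beta> n = 1 / qpoch q q (2 * n + 1)\<close>, \<open>\<beta> n = q ^ n / qpoch q q (2 * n + 1)\<close> and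
  \<open>\<beta> n = 1 / qpoch q q (2 * n)\<close>.\<close>

lemma theta_fin_odd: "theta_fin q 1 (int n) (int n + 1) - q * theta_fin q 5 (int n -
    1) (int n + 2) = inv_qpoch q (2 * int n + 1)"
  by (intro theta_fin_odd_step theta_fin_even) simp

lemma theta_fin_odd_power:
  "theta_fin q 4 (int n) (int n + 1) - q\<^sup>2 * theta_fin q 8 (int n - 1) (int n + 2) =
      q ^ n * inv_qpoch q (2 * int n + 1)"
proof -
  define m where "m = int n"
  \<comment> \<open>The left rule lowers 4 and 8 to the parameters 1 and 5 of
    \<open>theta_fin_even\<close>, with the extra power q^m; the other two sums cancel by
    \<open>theta_fin_4_8\<close>.\<close>
  have 1: "(1 - q powi (2 * m + 1)) * theta_fin q 4 m (m + 1) =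
      theta_fin q 4 (m - 1) (m + 1) + q powi m * theta_fin q 1 m m"
    using theta_fin_Pascal_left[of m "m + 1" 4] by (simp add: algebra_simps)
  have 2: "(1 - q powi (2 * m + 1)) * theta_fin q 8 (m - 1) (m + 2) =
      theta_fin q 8 (m - 2) (m + 2) + q powi (m - 1) * theta_fin q 5 (m - 1) (m + 1)"
    using theta_fin_Pascal_left[of "m - 1" "m + 2" 8] by (simp add: algebra_simps)
  have 3: "q\<^sup>2 * q powi (m - 1) = q powi m * q"
    using q0 by (simp add: power_int_diff power2_eq_square)
  have "(1 - q powi (2 * m + 1)) * (theta_fin q 4 m (m + 1) - q\<^sup>2 * theta_fin q 8 (m - 1) (m + 2)) =
    (1 - q powi (2 * m + 1)) * theta_fin q 4 m (m + 1) - q\<^sup>2 * ((1 -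
        q powi (2 * m + 1)) * theta_fin q 8 (m - 1) (m + 2))"
    by (simp add: algebra_simps)
  also have "\<dots> = q powi m * theta_fin q 1 m m - (q\<^sup>2 * q powi (m - 1)) * theta_fin q 5 (m -
      1) (m + 1)"
    unfolding 1 2 theta_fin_4_8 by (simp add: algebra_simps)
  also have "\<dots> = q powi m * (theta_fin q 1 m m - q * theta_fin q 5 (m - 1) (m + 1))"
    unfolding 3 by (simp add: algebra_simps)
  also have "\<dots> = q powi m * inv_qpoch q (2 * m)"
    unfolding m_def theta_fin_even ..
  also have "inv_qpoch q (2 * m) = (1 - q powi (2 * m + 1)) * inv_qpoch q (2 * m + 1)"
    using inv_qpoch_minus_1[of "2 * m + 1"] by simp
  finally show ?thesis
    using powi_not_1[of "2 * m + 1"] by (simp add: m_def)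
qed

lemma theta_fin_even':
  "theta_fin q (- 1) (int n) (int n + 1) - q * theta_fin q 5 (int n) (int n + 1) =
      inv_qpoch q (2 * int n)"
proof -
  \<comment> \<open>Both sums are brought to the last arguments n, n + 1, since the Bailey kernel
    needs indices of the form n - r and n + r + 1. The two corrections cancel.\<close>
  have 1: "theta_fin q 1 (int n) (int n) =
      theta_fin q (- 1) (int n) (int n + 1) - q powi (int n + 1) * theta_fin q 2 (int n) (int n + 1)"
    using theta_fin_reflect[of 1 "int n" "int n"] theta_fin_lower_right[of "- 1" "int n" "int n + 1"] by simp
  have 2: "theta_fin q 5 (int n - 1) (int n + 1) =
      theta_fin q 5 (int n) (int n + 1) - q powi int n * theta_fin q 2 (int n) (int n + 1)"
    using theta_fin_lower_left[of 5 "int n" "int n + 1"] by simp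
  have 3: "q powi (int n + 1) = q * q powi int n"
    using q0 by (simp add: power_int_add)
  show ?thesis
    using theta_fin_even[of n] unfolding 1 2 3 by (simp add: algebra_simps del: power_int_of_nat)
qed

end

section \<open>Bailey's transformation\<close>

lemma two_times_triangle: "2 * (n * (n + 1) div 2) = n * (n + 1)" for n :: nat
  by simp

lemma two_times_triangle_int: "2 * (m * (m + 1) div 2) = m * (m + 1)" for m :: int
  by simp

text \<open>Exponent bookkeeping for the shift n = m + r: r(r+1)/2 leaves the sum, m(m-1)/2 is the
  exponent in \<open>phi_term\<close>, and m(r+1) supplies the power of its argument.\<close>

lemma triangle_add:
  "(m + r) * (m + r + 1) div 2 = r * (r + 1) div 2 + m * (m - 1) div 2 + m * (r + 1)" for m r :: nat
proof (cases m)
  case (Suc k)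
  have "2 * ((m + r) * (m + r + 1) div 2) =
      2 * (r * (r + 1) div 2) + 2 * (k * (k + 1) div 2) + 2 * (m * (r + 1))"
    unfolding two_times_triangle by (simp add: Suc algebra_simps)
  moreover have "k * (k + 1) div 2 = m * (m - 1) div 2"
    by (simp add: Suc)
  ultimately show ?thesis
    by linarith
qed simp

context
  fixes q :: complex
  assumes q: "norm q < 1" and q0: "q \<noteq> 0"
begin

lemma inv_qpoch_bounded: "\<exists>C>0. \<forall>m. norm (inv_qpoch q m) \<le> C"
proof -
  obtain C where "C > 0" "\<And>n. norm (inverse (qpoch q q n)) \<le> C"
    using inverse_qpoch_bounded[OF q, of q] power_q_neq_1[OF q, of "Suc _"] by auto
  then have "norm (inv_qpoch q m) \<le> C" for m
    by (auto simp: inv_qpoch_def divide_inverse)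
  with \<open>C > 0\<close> show ?thesis by blast
qed

text \<open>Terms with n < r vanish. After n = m + r the series is a multiple of the 1phi1 sum with
  both parameters equal to A = -q^(r+1): A continues (-q)_r and A^2 = q^(2r+2) continues (q)_(2r+1).
  The prefactors thus complete both infinite products, and \<open>r\<close> survives only in a power
  of q.\<close>

lemma Bailey_kernel_nat:
  "((\<lambda>n. qpoch (- q) q n * q ^ (n * (n + 1) div 2) *
      inv_qpoch q (int n - int r) * inv_qpoch q (int n + int r + 1))
    has_sum q ^ (r * (r + 1) div 2) * (qpoch_inf (- q) q / qpoch_inf q q)) UNIV"
    (is "(?f has_sum _) _")
proof -
  define A where "A = - (q ^ (r + 1))"
  have A2: "A * A = q ^ (2 * r + 2)"
    by (simp add: A_def power_add[symmetric] mult_2)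
  have nz: "A * A * q ^ k \<noteq> 1" for k
    using power_q_neq_1[OF q, of "2 * r + 2 + k"] unfolding A2 by (simp add: power_add mult_ac)
  define c where "c = qpoch (- q) q r * q ^ (r * (r + 1) div 2) / qpoch q q (2 * r + 1)"
  have f: "?f (m + r) = c * phi_term q A A m" for m
  proof -
    have 1: "qpoch (- q) q (m + r) = qpoch (- q) q r * qpoch A q m"
      using qpoch_add[of "- q" q r m] by (simp add: A_def add.commute)
    have 2: "qpoch q q (m + 2 * r + 1) = qpoch q q (2 * r + 1) * qpoch (A * A) q m"
      using qpoch_add[of q q "2 * r + 1" m] unfolding A2 by (simp add: add_ac)
    have 3: "inv_qpoch q (int (m + r) + int r + 1) = 1 / qpoch q q (m + 2 * r + 1)"
    proof -
      have "int (m + r) + int r + 1 = int (m + 2 * r + 1)" by simp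
      then show ?thesis by (simp only: inv_qpoch_int)
    qed
    have 4: "(- A) ^ m = q ^ (m * (r + 1))"
      unfolding A_def minus_minus power_mult[symmetric] by (simp only: mult.commute)
    have 5: "inv_qpoch q (int (m + r) - int r) = 1 / qpoch q q m"
      by simp
    show ?thesis
      unfolding 1 2 3 5 phi_term_def c_def triangle_add power_add 4 by (simp add: mult_ac)
  qed
  have "(phi_term q A A has_sum qpoch_inf A q / qpoch_inf (A * A) q) UNIV"
    using nz by (intro phi_has_sum q)
  then have "((\<lambda>m. ?f (m + r)) has_sum c * (qpoch_inf A q / qpoch_inf (A * A) q)) UNIV"
    unfolding f by (rule has_sum_cmult_right)
  then have "(?f has_sum c * (qpoch_inf A q / qpoch_inf (A * A) q)) (range (\<lambda>m. m + r))"
    by (subst has_sum_reindex) (auto simp: o_def inj_on_def)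
  also have "?this \<longleftrightarrow> (?f has_sum c * (qpoch_inf A q / qpoch_inf (A * A) q)) UNIV"
  proof (rule has_sum_cong_neutral)
    fix n assume "n \<in> UNIV - range (\<lambda>m. m + r)"
    then have "n < r"
      by (metis DiffD2 le_add_diff_inverse2 not_less rangeI)
    then show "?f n = 0" by simp
  qed auto
  also have "c * (qpoch_inf A q / qpoch_inf (A * A) q)
      = q ^ (r * (r + 1) div 2) * (qpoch_inf (- q) q / qpoch_inf q q)"
    using qpoch_inf_split[OF q, of "- q" r] qpoch_inf_split[OF q, of q "2 * r + 1"]
    unfolding A2 unfolding c_def A_def by simp
  finally show ?thesis .
qed

text \<open>The substitution r -> -r - 1 exchanges the two reciprocal factors and fixes r(r+1),
  which settles negative \<open>r\<close>.\<close>

lemma Bailey_kernel: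
  "((\<lambda>n. qpoch (- q) q n * q ^ (n * (n + 1) div 2) *
      inv_qpoch q (int n - r) * inv_qpoch q (int n + r + 1))
    has_sum q powi (r * (r + 1) div 2) * (qpoch_inf (- q) q / qpoch_inf q q)) UNIV"
proof -
  have *: "q powi (int m * (int m + 1) div 2) = q ^ (m * (m + 1) div 2)" for m
  proof -
    have "int m * (int m + 1) div 2 = int (m * (m + 1) div 2)"
      by (simp only: zdiv_int of_nat_mult of_nat_add of_nat_1 of_nat_numeral)
    then show ?thesis
      by (simp only: power_int_of_nat)
  qed
  show ?thesis
  proof (cases "0 \<le> r")
    case True
    then obtain m where "r = int m" by (metis nonneg_int_cases)
    then show ?thesis
      using Bailey_kernel_nat[of m] by (simp only: *)
  next
    case False
    then obtain m where m: "- r - 1 = int m"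
        by (metis nonneg_int_cases linorder_not_le int_one_le_iff_zero_less le_diff_eq add_0 neg_0_less_iff_less)
    then have r: "r = - int m - 1" by simp
    have "r * (r + 1) = int m * (int m + 1)"
      by (simp add: r algebra_simps)
    moreover have "int n - r = int n + int m + 1" "int n + r + 1 = int n - int m" for n
      by (simp_all add: r)
    ultimately show ?thesis
      using Bailey_kernel_nat[of m] by (simp only: *) (simp only: mult_ac)
  qed
qed

text \<open>Interchange of the sums over n and k, followed by the kernel at r = 3k + c.\<close>

lemma Bailey_sum:
  assumes M: "\<And>k. norm (\<alpha> k) \<le> M"
  shows "((\<lambda>n. qpoch (- q) q n * q ^ (n * (n + 1) div 2) *
      (\<Sum>\<^sub>\<infinity>k. \<alpha> k * inv_qpoch q (int n - c - 3 * k) * inv_qpoch q (int n + c + 1 + 3 * k)))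
    has_sum qpoch_inf (- q) q / qpoch_inf q q *
      (\<Sum>\<^sub>\<infinity>k. \<alpha> k * q powi ((3 * k + c) * (3 * k + c + 1) div 2))) UNIV"
proof -
  define g where "g n = qpoch (- q) q n * q ^ (n * (n + 1) div 2)" for n
  define F where "F = (\<lambda>(n, k). g n * (\<alpha> k * inv_qpoch q (int n - c -
      3 * k) * inv_qpoch q (int n + c + 1 + 3 * k)))"
  define K where "K = qpoch_inf (- q) q / qpoch_inf q q"
  \<comment> \<open>The square root splits |q|^n into a factor decaying in n and one decaying in k:
    nonzero terms have |k| at most n + \<open>D\<close>, and the exponent n(n+1)/2 is at least
    n.\<close>
  define \<rho> where "\<rho> = sqrt (norm q)"
  have \<rho>: "0 < \<rho>" "\<rho> < 1" "norm q = \<rho> * \<rho>"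
    using q q0 by (auto simp: \<rho>_def)
  obtain C1 where C1: "C1 > 0" "\<And>n. norm (qpoch (- q) q n) \<le> C1"
    using qpoch_bounded[OF q] by blast
  obtain C2 where C2: "C2 > 0" "\<And>n. norm (inv_qpoch q n) \<le> C2"
    using inv_qpoch_bounded by blast
  have M0: "0 \<le> M"
    using M[of 0] norm_ge_zero order_trans by blast
  define D where "D = nat \<bar>c\<bar> + 1"
  have bound: "norm (F (n, k)) \<le> C1 * (M * C2 * C2) / \<rho> ^ D * (\<rho> ^ n * \<rho> ^ nat \<bar>k\<bar>)" for n k
  proof (cases "int n - c - 3 * k < 0 \<or> int n + c + 1 + 3 * k < 0")
    case True
    then have "F (n, k) = 0" by (auto simp: F_def)
    then show ?thesis using C1 C2 M0 \<rho> by simp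
  next
    case False
    then have "nat \<bar>k\<bar> \<le> n + D" by (auto simp: D_def)
    then have "\<rho> ^ (n + D) \<le> \<rho> ^ nat \<bar>k\<bar>"
      using \<rho> by (intro power_decreasing) auto
    then have "\<rho> ^ n * \<rho> ^ (n + D) \<le> \<rho> ^ n * \<rho> ^ nat \<bar>k\<bar>"
      using \<rho> by (intro mult_left_mono) auto
    then have 1: "norm q ^ n \<le> \<rho> ^ n * \<rho> ^ nat \<bar>k\<bar> / \<rho> ^ D"
      using \<rho> by (simp add: power_add power_mult_distrib field_simps)
    have "n \<le> n * (n + 1) div 2"
      by (cases n) auto
    then have "norm q ^ (n * (n + 1) div 2) \<le> norm q ^ n"
      using q by (intro power_decreasing) auto
    with 1 have 2: "norm q ^ (n * (n + 1) div 2) \<le> \<rho> ^ n * \<rho> ^ nat \<bar>k\<bar> / \<rho> ^ D"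
      by simp
    have "norm (F (n, k)) \<le> C1 * (\<rho> ^ n * \<rho> ^ nat \<bar>k\<bar> / \<rho> ^ D) * (M * C2 * C2)"
      unfolding F_def g_def prod.case norm_mult norm_power
      using C1 C2 M0 M 2 \<rho> by (intro mult_mono) auto
    then show ?thesis by (simp add: mult_ac)
  qed
  have "(\<lambda>(n, k). \<rho> ^ n * \<rho> ^ nat \<bar>k\<bar>) summable_on (UNIV :: nat set) \<times> (UNIV :: int set)"
    using \<rho> by (intro summable_on_times summable_on_int_geometric)
      (auto intro!: summable_nonneg_imp_summable_on summable_geometric)
  then have "(\<lambda>p. C1 * (M * C2 * C2) / \<rho> ^ D * (case p of (n, k) \<Rightarrow> \<rho> ^ n * \<rho> ^ nat \<bar>k\<bar>))
      summable_on (UNIV :: nat set) \<times> (UNIV :: int set)"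
    by (rule summable_on_cmult_right)
  then have "(\<lambda>p. norm (F p)) summable_on UNIV \<times> UNIV"
    by (rule Infinite_Sum.abs_summable_on_comparison_test') (use bound in auto)
  then have "F summable_on UNIV \<times> UNIV"
    by (rule abs_summable_summable)
  then obtain T where T: "(F has_sum T) (UNIV \<times> UNIV)"
    by (auto simp: summable_on_def)
  have "((\<lambda>n. g n * (\<Sum>\<^sub>\<infinity>k. \<alpha> k * inv_qpoch q (int n - c -
      3 * k) * inv_qpoch q (int n + c + 1 + 3 * k)))
     has_sum T) UNIV"
    by (rule has_sum_SigmaD[OF T]) (unfold F_def prod.case,
        intro has_sum_cmult_right has_sum_infsum summable_inv_qpoch_pair)
  moreover have "T = K * (\<Sum>\<^sub>\<infinity>k. \<alpha> k * q powi ((3 * k + c) * (3 * k + c + 1) div 2))"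
  proof -
    have "((\<lambda>(k, n). F (n, k)) has_sum T) (UNIV \<times> UNIV)"
      using T by (subst (asm) has_sum_swap) simp
    then have "((\<lambda>k. \<alpha> k * (q powi ((3 * k + c) * (3 * k + c + 1) div 2) * K)) has_sum T) UNIV"
    proof (rule has_sum_SigmaD)
      fix k
      have "(\<lambda>n. case (k, n) of (k, n) \<Rightarrow> F (n, k)) = (\<lambda>n. \<alpha> k * (g n *
         inv_qpoch q (int n - (3 * k + c)) * inv_qpoch q (int n + (3 * k + c) + 1)))"
        by (auto simp: F_def algebra_simps)
      then show "((\<lambda>n. case (k, n) of (k, n) \<Rightarrow> F (n, k)) has_sum
           \<alpha> k * (q powi ((3 * k + c) * (3 * k + c + 1) div 2) * K)) UNIV"
        using has_sum_cmult_right[OF Bailey_kernel[of "3 * k + c"], of "\<alpha> k"]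
        by (simp add: g_def K_def)
    qed
    then have "((\<lambda>k. K * (\<alpha> k * q powi ((3 * k + c) * (3 * k + c + 1) div 2))) has_sum T) UNIV"
      by (simp add: mult_ac)
    then have "T = (\<Sum>\<^sub>\<infinity>k. K * (\<alpha> k * q powi ((3 * k + c) * (3 * k + c + 1) div 2)))"
      by (rule infsumI[symmetric])
    then show ?thesis
      by (simp only: infsum_cmult_right')
  qed
  ultimately show ?thesis
    by (simp add: g_def K_def)
qed

lemma norm_powi_le: "m \<le> n \<Longrightarrow> norm (q powi n) \<le> norm q powi m"
  using q q0 by (simp add: norm_power_int power_int_decreasing)

text \<open>Here c = 0 and c = 1 are the classes r = 3k and r = 3k + 1. The bound needed for the
  interchange follows from 2 (6k^2 + uk + u^2) = (u + k)^2 + 11k^2 + u^2.\<close>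

lemma Bailey_theta_fin:
  assumes e: "\<And>k. e k = 6 * k\<^sup>2 + u * k + (3 * k + c) * (3 * k + c + 1) div 2"
  shows "((\<lambda>n. qpoch (- q) q n * q ^ (n * (n + 1) div 2) * theta_fin q u (int n -
      c) (int n + c + 1))
    has_sum qpoch_inf (- q) q / qpoch_inf q q * (\<Sum>\<^sub>\<infinity>k. q powi e k)) UNIV"
proof -
  have "norm (q powi (6 * k\<^sup>2 + u * k)) \<le> norm q powi (- u\<^sup>2)" for k
  proof (rule norm_powi_le)
    have "0 \<le> (u + k)\<^sup>2 + 11 * k\<^sup>2 + u\<^sup>2" by simp
    then show "- u\<^sup>2 \<le> 6 * k\<^sup>2 + u * k"
      by (simp add: power2_eq_square algebra_simps)
  qed
  from Bailey_sum[OF this, where c = c] show ?thesis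
    by (simp add: theta_fin_def e power_int_add q0)
qed

end

section \<open>The quintuple product identity\<close>

text \<open>The exponent is the pentagonal number (3k^2 - k)/2, written so that the division is
  visibly exact.\<close>

definition quintuple_term :: "complex \<Rightarrow> complex \<Rightarrow> int \<Rightarrow> complex" where
  "quintuple_term q x k = (- 1) powi k * (1 + x * q powi k) * x powi (3 * k) *
     q powi (3 * (k * (k - 1) div 2) + k)"

lemma summable_on_theta_int:
  fixes b r :: real
  assumes "0 < b" "0 < r" "r < 1"
  shows "(\<lambda>k::int. b powi k * r powi (k * (k - 1) div 2)) summable_on UNIV"
proof -
  have g: "(\<lambda>m. c ^ m * r ^ (m * (m - 1) div 2))
      summable_on (UNIV :: nat set)" if "0 < c" for c :: real
    using assms that by (intro summable_nonneg_imp_summable_on summable_theta_nat) auto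
  have tri: "int m * (int m - 1) div 2 = int (m * (m - 1) div 2)" for m
  proof -
    have "int m * (int m - 1) = int (m * (m - 1))"
      by (cases m) (auto simp: algebra_simps)
    then show ?thesis
      by (simp only: zdiv_int of_nat_numeral)
  qed
  have tri': "- int m * (- int m - 1) div 2 = int m + int (m * (m - 1) div 2)" for m
  proof -
    have "- int m * (- int m - 1) = 2 * int m + int m * (int m - 1)"
      by (simp add: algebra_simps)
    then show ?thesis
      unfolding tri[symmetric] by simp
  qed
  have 1: "(\<lambda>k::int. b powi k * r powi (k * (k - 1) div 2)) summable_on {0..}"
  proof (rule summable_on_reindex_bij_witness[THEN iffD2, OF _ _ _ _ _ g[OF assms(1)],
         of _ int nat])
    fix k :: int assume "k \<in> {0..}"
    then have "k = int (nat k)" by simp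
    then obtain m where k: "k = int m" by blast
    show "b ^ nat k * r ^ (nat k * (nat k - 1) div 2) = b powi k * r powi (k * (k - 1) div 2)"
      unfolding k tri nat_int power_int_of_nat ..
  qed auto
  have 2: "(\<lambda>k::int. b powi k * r powi (k * (k - 1) div 2)) summable_on {..0}"
  proof (rule summable_on_reindex_bij_witness[THEN iffD2, OF _ _ _ _ _ g[of "r / b"],
         of _ "\<lambda>m. - int m" "\<lambda>k. nat (- k)"])
    fix k :: int assume "k \<in> {..0}"
    then have "k = - int (nat (- k))" by simp
    then obtain m where k: "k = - int m" by blast
    show "(r / b) ^ nat (- k) * r ^ (nat (- k) * (nat (- k) - 1) div 2)
        = b powi k * r powi (k * (k - 1) div 2)"
      using assms unfolding k tri' minus_minus nat_int
      by (subst power_int_add) (simp_all add: power_int_minus power_divide field_simps)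
  qed (use assms in auto)
  have "UNIV = {0::int..} \<union> {..0}" by auto
  then show ?thesis
    using summable_on_union[OF 1 2] by simp
qed

text \<open>Factor by factor, 1 - a/q^i = -(a/q^i) (1 - q^i/a) for i = 1, ..., j.\<close>

lemma qpoch_reverse:
  assumes "a \<noteq> 0" "q \<noteq> 0"
  shows "qpoch (a / q ^ j) q j = (- a) ^ j / q ^ (j * (j + 1) div 2) * qpoch (q / a) q j"
proof (induction j)
  case (Suc j)
  have e: "Suc j * (Suc j + 1) div 2 = j * (j + 1) div 2 + Suc j"
    by simp
  have "qpoch (a / q ^ Suc j) q (Suc j) = (1 - a / q ^ Suc j) * qpoch (a / q ^ j) q j"
    using assms by (simp add: qpoch_Suc_left)
  also have "1 - a / q ^ Suc j = - a / q ^ Suc j * (1 - q / a * q ^ j)"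
    using assms by (simp add: field_simps)
  finally show ?case
    unfolding Suc e by (simp add: qpoch_Suc power_add mult_ac)
qed simp

text \<open>Summand of a one-sided finite form of the quintuple product identity. Setting y = x/q^N
  and n = 2N centres the index at k = N and makes the sum bilateral.\<close>

definition quint_fin_term :: "complex \<Rightarrow> complex \<Rightarrow> nat \<Rightarrow> nat \<Rightarrow> complex" where
  "quint_fin_term q y n k = (1 + y * q ^ k) * y ^ k * q ^ k\<^sup>2
     / (qpoch q q k * qpoch q q (n - k) * qpoch (y\<^sup>2 * q ^ k) q (Suc n))"

text \<open>A Wilf-Zeilberger certificate: its differences in \<open>k\<close> are those of \<open>quint_fin_term\<close> in \<open>n\<close>,
  up to the factor by which the sum over \<open>k\<close> changes.\<close>

definition quint_cert :: "complex \<Rightarrow> complex \<Rightarrow> nat \<Rightarrow> nat \<Rightarrow> complex" where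
  "quint_cert q y n k = y ^ Suc k * q ^ (k\<^sup>2 + k + Suc n)
     / (qpoch q q k * qpoch q q (n - k) * qpoch (y\<^sup>2 * q ^ Suc k) q (Suc n))"

context
  fixes q :: complex
  assumes q: "norm q < 1" and q0: "q \<noteq> 0"
begin

text \<open>Once \<open>D\<close> is factored out, a polynomial identity in y, \<open>Y\<close> =
  q^(m+1) and \<open>J\<close> = q^(n-m) remains. The condition m < n keeps the natural-number
  subtraction n - (m + 1) from being truncated.\<close>

lemma quint_WZ:
  assumes y: "\<And>k. y\<^sup>2 * q ^ k \<noteq> 1" and m: "m < n"
  shows "(1 - q ^ Suc n) * (1 - y * q ^ Suc n) * quint_fin_term q y (Suc n) (Suc m)
    - quint_fin_term q y n (Suc m) = quint_cert q y n m - quint_cert q y n (Suc m)"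
proof -
  obtain j where n: "n = Suc m + j"
    using m less_iff_Suc_add by auto
  define Y where "Y = q ^ Suc m"
  define J where "J = q ^ Suc j"
  define D where "D = y ^ Suc m * q ^ (Suc m)\<^sup>2 /
     (qpoch q q (Suc m) * qpoch q q (Suc j) * qpoch (y\<^sup>2 * Y) q (Suc (Suc n)))"
  have P: "q ^ Suc n = Y * J"
    by (simp add: n Y_def J_def power_add)
  have nz: "1 - y\<^sup>2 * Y * (Y * J) \<noteq> 0" "1 - y\<^sup>2 * Y \<noteq> 0" "1 - Y \<noteq> 0" "1 - J \<noteq> 0"
    using y[of "Suc m + Suc n"] y[of "Suc m"] power_q_neq_1[OF q, of "Suc m"]
      power_q_neq_1[OF q, of "Suc j"] unfolding power_add P
    by (auto simp: Y_def J_def mult_ac)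
  have qm: "qpoch q q (Suc m) = qpoch q q m * (1 - Y)" "qpoch q q (Suc j) = qpoch q q j * (1 - J)"
    by (simp_all add: qpoch_Suc Y_def J_def)
  have qy: "qpoch (y\<^sup>2 * Y) q (Suc (Suc n)) = qpoch (y\<^sup>2 * Y) q (Suc n) * (1 - y\<^sup>2 * Y * (Y * J))"
    using qpoch_Suc[of "y\<^sup>2 * Y" q "Suc n"] unfolding P .
  have qy': "qpoch (y\<^sup>2 * Y) q (Suc (Suc n)) = (1 - y\<^sup>2 * Y) * qpoch (y\<^sup>2 * (q * Y)) q (Suc n)"
    by (subst qpoch_Suc_left) (simp add: mult_ac)
  have 1: "quint_fin_term q y (Suc n) (Suc m) = D * (1 + y * Y)"
    unfolding quint_fin_term_def D_def Y_def[symmetric] by (simp add: n)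
  have 2: "quint_fin_term q y n (Suc m) = D * ((1 + y * Y) * (1 - J) * (1 - y\<^sup>2 * Y * (Y * J)))"
    unfolding quint_fin_term_def D_def Y_def[symmetric] qm(2) qy using nz by (simp add: n mult_ac)
  have "q ^ (m\<^sup>2 + m + Suc n) = q ^ ((Suc m)\<^sup>2 + Suc j)"
    by (rule arg_cong[of _ _ "power q"]) (simp add: n power2_eq_square)
  then have e: "q ^ (m\<^sup>2 + m + Suc n) = q ^ (Suc m)\<^sup>2 * J"
    unfolding J_def by (simp only: power_add)
  have nm: "n - m = Suc j" by (simp add: n)
  have 3: "quint_cert q y n m = D * ((1 - Y) * (1 - y\<^sup>2 * Y * (Y * J)) * J)"
    unfolding quint_cert_def D_def Y_def[symmetric] e nm qm(1) qy using nz by (simp add: mult_ac)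
  have e': "q ^ ((Suc m)\<^sup>2 + Suc m + Suc n) = q ^ (Suc m)\<^sup>2 * Y * (Y * J)"
    unfolding power_add[of q _ "Suc n"] P by (simp only: power_add Y_def)
  have nm': "n - Suc m = j" by (simp add: n)
  have YY: "q ^ Suc (Suc m) = q * Y" by (simp add: Y_def)
  have 4: "quint_cert q y n (Suc m) = D * (y * Y * (Y * J) * (1 - J) * (1 - y\<^sup>2 * Y))"
    unfolding quint_cert_def D_def YY e' nm' qm(2) qy' using nz by (simp add: mult_ac)
  show ?thesis
    unfolding 1 2 3 4 P by (simp add: power2_eq_square algebra_simps)
qed

text \<open>Induction on \<open>n\<close>: the factor \<open>e\<close> is the quotient of
  consecutive right-hand sides, and the certificate shows that the left-hand sides have the same
  quotient.\<close>

lemma quint_fin: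
  assumes y2: "\<And>k. y\<^sup>2 * q ^ k \<noteq> 1" and y1: "\<And>k. y * q ^ k \<noteq> 1"
  shows "(\<Sum>k\<le>n. quint_fin_term q y n k) = 1 / (qpoch q q n * qpoch y q (Suc n))"
proof (induction n)
  case 0
  have "(1 - y\<^sup>2) = (1 - y) * (1 + y)"
    by (simp add: power2_eq_square algebra_simps)
  moreover have "1 - y\<^sup>2 \<noteq> 0"
    using y2[of 0] by simp
  ultimately show ?case
    by (simp add: quint_fin_term_def qpoch_Suc)
next
  case (Suc n)
  define e where "e = (1 - q ^ Suc n) * (1 - y * q ^ Suc n)"
  have nz: "1 - q ^ Suc n \<noteq> 0" "1 - y * q ^ Suc n \<noteq> 0" "1 - y\<^sup>2 \<noteq> 0"
    "\<And>k. 1 - y\<^sup>2 * q ^ k \<noteq> 0"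
    using power_q_neq_1[OF q, of "Suc n"] y1[of "Suc n"] y2 y2[of 0] by auto
  \<comment> \<open>Telescoping leaves only the upper end: at k = 0 the difference is already minus
    the certificate.\<close>
  have part: "(\<Sum>k\<le>m. e * quint_fin_term q y (Suc n) k - quint_fin_term q y n k) =
      - quint_cert q y n m"
    if "m \<le> n" for m
    using that
  proof (induction m)
    case 0
    define P where "P = q ^ Suc n"
    define D where "D = 1 / (qpoch q q (Suc n) * qpoch (y\<^sup>2) q (Suc (Suc n)))"
    have qq: "qpoch q q (Suc n) = qpoch q q n * (1 - P)"
      by (simp add: qpoch_Suc P_def)
    have qy: "qpoch (y\<^sup>2) q (Suc (Suc n)) = qpoch (y\<^sup>2) q (Suc n) * (1 - y\<^sup>2 * P)"
      using qpoch_Suc[of "y\<^sup>2" q "Suc n"] by (simp add: P_def)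
    have qy': "qpoch (y\<^sup>2) q (Suc (Suc n)) = (1 - y\<^sup>2) * qpoch (y\<^sup>2 * q) q (Suc n)"
      by (rule qpoch_Suc_left)
    have 1: "quint_fin_term q y (Suc n) 0 = D * (1 + y)"
      by (simp add: quint_fin_term_def D_def)
    have 2: "quint_fin_term q y n 0 = D * ((1 + y) * (1 - P) * (1 - y\<^sup>2 * P))"
      unfolding D_def qq qy using nz(1) nz(4)[of "Suc n"]
      by (simp add: quint_fin_term_def P_def)
    have 3: "quint_cert q y n 0 = D * (y * P * (1 - P) * (1 - y\<^sup>2))"
      unfolding D_def qq qy' using nz(1,3)
      by (simp add: quint_cert_def P_def)
    show ?case
      by (simp add: 1 2 3 e_def P_def[symmetric] del: power_Suc) (simp add: power2_eq_square algebra_simps)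
  next
    case (Suc m)
    then show ?case
      using quint_WZ[OF y2, of m n] by (simp add: e_def)
  qed
  define Y where "Y = q ^ Suc n"
  \<comment> \<open>The index k = n + 1 occurs only at level n + 1; its term cancels what the
    telescoping leaves over.\<close>
  have "e * quint_fin_term q y (Suc n) (Suc n) = quint_cert q y n n"
  proof -
    have y: "1 - y\<^sup>2 * (Y * Y) \<noteq> 0"
      using nz(4)[of "Suc n + Suc n"] by (simp add: Y_def power_add mult_ac)
    have f: "1 - y\<^sup>2 * (Y * Y) = (1 - y * Y) * (1 + y * Y)"
      by (simp add: power2_eq_square algebra_simps)
    have qq: "qpoch q q (Suc n) = qpoch q q n * (1 - Y)"
      by (simp add: qpoch_Suc Y_def)
    have qy: "qpoch (y\<^sup>2 * Y) q (Suc (Suc n)) =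
        qpoch (y\<^sup>2 * Y) q (Suc n) * ((1 - y * Y) * (1 + y * Y))"
      using qpoch_Suc[of "y\<^sup>2 * Y" q "Suc n"] f by (simp add: Y_def mult.assoc)
    have "q ^ (n\<^sup>2 + n + Suc n) = q ^ (Suc n)\<^sup>2"
      by (rule arg_cong[of _ _ "power q"]) (simp add: power2_eq_square)
    then show ?thesis
      unfolding quint_fin_term_def quint_cert_def e_def Y_def[symmetric] qq qy
      using y f nz(1) by (simp add: Y_def[symmetric] del: power_Suc)
  qed
  moreover have "(\<Sum>k\<le>n. e * quint_fin_term q y (Suc n) k) =
      (\<Sum>k\<le>n. quint_fin_term q y n k) - quint_cert q y n n"
    using part[of n] by (simp add: sum_subtractf algebra_simps)
  ultimately have "e * (\<Sum>k\<le>Suc n. quint_fin_term q y (Suc n) k) = (\<Sum>k\<le>n. quint_fin_term q y n k)"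
    by (simp add: sum_distrib_left distrib_left)
  moreover have "e \<noteq> 0"
    using nz by (simp add: e_def)
  ultimately have "(\<Sum>k\<le>Suc n. quint_fin_term q y (Suc n) k) = (\<Sum>k\<le>n. quint_fin_term q y n k) / e"
    by (metis nonzero_mult_div_cancel_left)
  then have "(\<Sum>k\<le>Suc n. quint_fin_term q y (Suc n) k) = 1 / (qpoch q q n * qpoch y q (Suc n)) / e"
    unfolding Suc .
  also have "\<dots> = 1 / (qpoch q q (Suc n) * qpoch y q (Suc (Suc n)))"
    by (simp add: e_def qpoch_Suc[of _ _ "Suc n"] qpoch_Suc[of q q n] mult_ac)
  finally show ?case .
qed

text \<open>The factor 1 + x q^k splits the majorant into two theta series with base |q|^3.\<close>

lemma quintuple_term_summable:
  assumes x: "x \<noteq> 0"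
  shows "(\<lambda>k. norm (quintuple_term q x k)) summable_on UNIV"
proof -
  define r where "r = norm q"
  have r: "0 < r" "r < 1" "0 < norm x"
    using q q0 x by (auto simp: r_def)
  define b where "b = norm x ^ 3 * r"
  have b: "0 < b"
    using r by (simp add: b_def)
  define t where "t c k = c powi k * (r ^ 3) powi (k * (k - 1) div 2)" for c and k :: int
  have "t b summable_on UNIV" "t (b * r) summable_on UNIV"
    unfolding t_def using r b by (intro summable_on_theta_int; simp add: power_less_one_iff)+
  then have "(\<lambda>k. t b k + norm x * t (b * r) k) summable_on UNIV"
    by (intro summable_on_add summable_on_cmult_right)
  then show ?thesis
  proof (rule Infinite_Sum.abs_summable_on_comparison_test')
    fix k :: int
    have t: "t b k = norm x powi (3 * k) * r powi (3 * (k * (k - 1) div 2) + k)"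
      using r by (simp add: t_def b_def power_int_mult_distrib power_int_mult power_int_add)
    have t': "t (b * r) k = t b k * r powi k"
      by (simp add: t_def power_int_mult_distrib)
    have "norm (1 + x * q powi k) \<le> 1 + norm x * r powi k"
      by (rule order.trans[OF norm_triangle_ineq]) (simp add: norm_mult norm_power_int r_def)
    then have "norm (1 + x * q powi k) * t b k \<le> (1 + norm x * r powi k) * t b k"
      using r b by (intro mult_right_mono) (auto simp: t_def)
    moreover have "norm (quintuple_term q x k) = norm (1 + x * q powi k) * t b k"
      unfolding quintuple_term_def t by (simp add: norm_mult norm_power_int r_def)
    ultimately show "norm (quintuple_term q x k) \<le> t b k + norm x * t (b * r) k"
      unfolding t' by (simp add: algebra_simps)
  qed
qed

text \<open>With j = 2N - m one has y^2 q^m = x^2/q^j, so the long factorial has j factors that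
  reverse to (q/x^2)_j, followed by (x^2)_(m+1). The multiplier on the left is the one produced by
  reversing (x/q^N)_N on the other side of the finite identity.\<close>

lemma quintuple_shift:
  assumes x: "x \<noteq> 0" and m: "m \<le> 2 * N"
  shows "quint_fin_term q (x / q ^ N) (2 * N) m * ((- x) ^ N / q ^ (N * (N + 1) div 2)) =
    quintuple_term q x (int m - int N) / (qpoch q q m * qpoch q q (2 * N - m)
       * qpoch (x\<^sup>2) q (Suc m) * qpoch (q / x\<^sup>2) q (2 * N - m))"
proof -
  define j where "j = 2 * N - m"
  define k where "k = int m - int N"
  have jm: "j + Suc m = Suc (2 * N)"
    using m by (simp add: j_def)
  have "2 * N = m + j"
    using m by (simp add: j_def)
  then have "(x / q ^ N)\<^sup>2 * q ^ m = x\<^sup>2 / q ^ j"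
    using q0 by (simp add: power_divide power_mult[symmetric] mult.commute[of N] power_add)
  moreover have "qpoch (x\<^sup>2 / q ^ j) q (Suc (2 * N)) =
      qpoch (x\<^sup>2 / q ^ j) q j * qpoch (x\<^sup>2) q (Suc m)"
    using q0 qpoch_add[of "x\<^sup>2 / q ^ j" q j "Suc m"] unfolding jm by simp
  ultimately have 1: "qpoch ((x / q ^ N)\<^sup>2 * q ^ m) q (Suc (2 * N)) =
      (- (x\<^sup>2)) ^ j / q ^ (j * (j + 1) div 2) * qpoch (q / x\<^sup>2) q j * qpoch (x\<^sup>2) q (Suc m)"
    using qpoch_reverse[of "x\<^sup>2" q j] x q0 by simp
  have 2: "x / q ^ N * q ^ m = x * q powi k"
    using q0 by (simp add: k_def power_int_diff)
  have 3: "(x / q ^ N) ^ m * q ^ m\<^sup>2 * ((- x) ^ N / q ^ (N * (N + 1) div 2)) =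
     (- 1) powi k * x powi (3 * k) * q powi (3 * (k * (k - 1) div 2) + k) *
     ((- (x\<^sup>2)) ^ j / q ^ (j * (j + 1) div 2))"
  proof -
    have jN: "int j = int N - k" "int m = int N + k"
      using m by (auto simp: j_def k_def)
    have s: "(- 1 :: complex) ^ N = (- 1) powi k * (- 1) ^ j"
    proof -
      have N: "int N = k + int j" using jN by simp
      have "(- 1 :: complex) ^ N = (- 1) powi int N"
        by (simp only: power_int_of_nat)
      also have "\<dots> = (- 1) powi k * (- 1) powi int j"
        unfolding N by (rule power_int_add) simp
      finally show ?thesis by (simp only: power_int_of_nat)
    qed
    have X: "x ^ m * x ^ N = x powi (3 * k) * (x\<^sup>2) ^ j"
    proof -
      have "x ^ m * x ^ N = x powi (int m + int N)"
        by (simp only: power_int_add[OF disjI1, OF x] power_int_of_nat)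
      also have "int m + int N = 3 * k + int (2 * j)"
        using jN by simp
      also have "x powi (3 * k + int (2 * j)) = x powi (3 * k) * (x\<^sup>2) ^ j"
        by (simp only: power_int_add[OF disjI1, OF x] power_int_of_nat power_mult)
      finally show ?thesis .
    qed
    have Q: "q ^ m\<^sup>2 * q ^ (j * (j + 1) div 2) =
        q powi (3 * (k * (k - 1) div 2) + k) * (q ^ (N * m) * q ^ (N * (N + 1) div 2))"
    proof -
      have tr: "2 * int (n * (n + 1) div 2) = int n * (int n + 1)" for n
      proof -
        have "2 * int (n * (n + 1) div 2) = int (2 * (n * (n + 1) div 2))"
          by (simp only: of_nat_mult of_nat_numeral)
        then show ?thesis
          unfolding two_times_triangle by (simp only: of_nat_mult of_nat_add of_nat_1)
      qed
      define tj tN tk where "tj = int (j * (j + 1) div 2)" and "tN = int (N * (N + 1) div 2)"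
        and "tk = k * (k - 1) div 2"
      have t: "2 * tj = (int N - k) * (int N - k + 1)" "2 * tN = int N * (int N + 1)" "2 * tk =
          k * (k - 1)"
        unfolding tj_def tN_def tk_def tr jN by simp_all
      have "2 * (int (m\<^sup>2) + tj) = 2 * (3 * tk + k + (int (N * m) + tN))"
        using t by (simp add: jN power2_eq_square algebra_simps)
      then have "int (m\<^sup>2) + tj = 3 * tk + k + (int (N * m) + tN)"
        by (rule mult_left_cancel[THEN iffD1, OF zero_neq_numeral[symmetric]])
      then have "q powi (int (m\<^sup>2) + tj) = q powi (3 * tk + k + (int (N * m) + tN))"
        by (rule arg_cong)
      then show ?thesis
        unfolding tj_def tN_def tk_def by (simp only: power_int_add[OF disjI1, OF q0] power_int_of_nat)
    qed
    have a: "(- x) ^ N = (- 1) ^ N * x ^ N" "(- (x\<^sup>2)) ^ j = (- 1) ^ j * (x\<^sup>2) ^ j"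
      by (rule power_minus)+
    have "(x / q ^ N) ^ m * q ^ m\<^sup>2 * ((- x) ^ N / q ^ (N * (N + 1) div 2)) =
      (- 1) ^ N * (x ^ m * x ^ N) * (q ^ m\<^sup>2 * q ^ (j * (j + 1) div 2)) /
      (q ^ (N * m) * q ^ (N * (N + 1) div 2) * q ^ (j * (j + 1) div 2))"
      unfolding a using q0 by (simp add: power_divide power_mult)
    also have "\<dots> = (- 1) powi k * (- 1) ^ j * (x powi (3 * k) * (x\<^sup>2) ^ j) *
       q powi (3 * (k * (k - 1) div 2) + k) / q ^ (j * (j + 1) div 2)"
      unfolding s X Q using q0 by simp
    finally show ?thesis
      unfolding a by simp
  qed
  have nz: "(- (x\<^sup>2)) ^ j \<noteq> 0" "q ^ (j * (j + 1) div 2) \<noteq> 0"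
    using x q0 by simp_all
  have "quint_fin_term q (x / q ^ N) (2 * N) m * ((- x) ^ N / q ^ (N * (N + 1) div 2)) =
    (1 + x * q powi k) * ((x / q ^ N) ^ m * q ^ m\<^sup>2 * ((- x) ^ N / q ^ (N * (N + 1) div 2)))
     / (qpoch q q m * qpoch q q j * ((- (x\<^sup>2)) ^ j / q ^ (j * (j + 1) div 2) * qpoch (q /
         x\<^sup>2) q j * qpoch (x\<^sup>2) q (Suc m)))"
    unfolding quint_fin_term_def 1 2 j_def[symmetric] by (simp add: mult_ac)
  also have "\<dots> = quintuple_term q x k / (qpoch q q m * qpoch q q j * qpoch (x\<^sup>2) q (Suc m) * qpoch (q / x\<^sup>2) q j)"
    unfolding 3 quintuple_term_def using x q0 by (simp add: mult_ac)
  finally show ?thesis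
    by (simp add: k_def j_def)
qed

lemma quintuple_fin:
  assumes x: "x \<noteq> 0" and nz: "\<And>k. x\<^sup>2 * q powi k \<noteq> 1"
  shows "(\<Sum>m\<le>2 * N. quintuple_term q x (int m - int N) / (qpoch q q m * qpoch q q (2 * N - m)
       * qpoch (x\<^sup>2) q (Suc m) * qpoch (q / x\<^sup>2) q (2 * N - m)))
     = 1 / (qpoch q q (2 * N) * qpoch x q (Suc N) * qpoch (q / x) q N)"
proof -
  define y where "y = x / q ^ N"
  have y2: "y\<^sup>2 * q ^ k \<noteq> 1" for k
    using nz[of "int k - 2 * int N"] q0
    by (simp add: y_def power_divide power_int_diff power_mult[symmetric] mult.commute power_int_mult)
  have y1: "y * q ^ k \<noteq> 1" for k
  proof
    assume "y * q ^ k = 1"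
    then have "(y * q ^ k)\<^sup>2 = 1" by simp
    then show False
      using y2[of "k * 2"] by (simp add: power_mult_distrib power_mult)
  qed
  have "qpoch y q (N + Suc N) = qpoch y q N * qpoch x q (Suc N)"
    unfolding qpoch_add using q0 by (simp add: y_def)
  also have "qpoch y q N = (- x) ^ N / q ^ (N * (N + 1) div 2) * qpoch (q / x) q N"
    unfolding y_def by (rule qpoch_reverse[OF x q0])
  finally have qy: "qpoch y q (Suc (2 * N)) =
      (- x) ^ N / q ^ (N * (N + 1) div 2) * qpoch (q / x) q N * qpoch x q (Suc N)"
    by (simp add: mult_2)
  have "(\<Sum>m\<le>2 * N. quintuple_term q x (int m - int N) / (qpoch q q m * qpoch q q (2 * N - m)
       * qpoch (x\<^sup>2) q (Suc m) * qpoch (q / x\<^sup>2) q (2 * N - m)))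
     = (\<Sum>m\<le>2 * N. quint_fin_term q y (2 * N) m * ((- x) ^ N / q ^ (N * (N + 1) div 2)))"
    unfolding y_def by (intro sum.cong refl quintuple_shift[symmetric] x) auto
  also have "\<dots> = 1 / (qpoch q q (2 * N) * qpoch y q (Suc (2 * N))) * ((- x) ^ N /
      q ^ (N * (N + 1) div 2))"
    unfolding sum_distrib_right[symmetric] quint_fin[OF y2 y1] ..
  also have "\<dots> = 1 / (qpoch q q (2 * N) * qpoch x q (Suc N) * qpoch (q / x) q N)"
    unfolding qy using x q0 by (simp add: mult_ac)
  finally show ?thesis .
qed

text \<open>Tannery's theorem, applied to \<open>quintuple_fin\<close> as N tends to infinity. The
  nonvanishing hypothesis also covers the denominators with x and q/x, because x q^k = 1 gives x^2
  q^(2k) = 1.\<close>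

theorem quintuple_product:
  assumes x: "x \<noteq> 0" and nz: "\<And>k. x\<^sup>2 * q powi k \<noteq> 1"
  shows "(quintuple_term q x has_sum
     qpoch_inf q q * qpoch_inf (x\<^sup>2) q * qpoch_inf (q / x\<^sup>2) q / (qpoch_inf x q * qpoch_inf (q /
         x) q)) UNIV"
    (is "(_ has_sum ?rhs) _")
proof -
  have nz1: "x\<^sup>2 * q ^ k \<noteq> 1" for k
    using nz[of "int k"] by simp
  have nz2: "q / x\<^sup>2 * q ^ k \<noteq> 1" for k
    using nz[of "- int (Suc k)"] x q0
    by (simp add: power_int_minus field_simps del: of_nat_Suc)
  have nz3: "qpoch_inf x q \<noteq> 0" "qpoch_inf (q / x) q \<noteq> 0"
  proof -
    have "x * q powi k \<noteq> 1" for k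
    proof
      assume "x * q powi k = 1"
      then have "(x * q powi k)\<^sup>2 = 1" by simp
      then show False
        using nz[of "k * 2"] by (simp add: power_mult_distrib power_int_mult)
    qed
    note n = this
    have "x * q ^ k \<noteq> 1" for k
      using n[of "int k"] by simp
    then show "qpoch_inf x q \<noteq> 0"
      by (intro qpoch_inf_nonzero q)
    have "q / x * q ^ k \<noteq> 1" for k
      using n[of "- int (Suc k)"] x q0
      by (simp add: power_int_minus field_simps del: of_nat_Suc)
    then show "qpoch_inf (q / x) q \<noteq> 0"
      by (intro qpoch_inf_nonzero q)
  qed
  have nzq: "q * q ^ k \<noteq> 1" for k
    using power_q_neq_1[OF q, of "Suc k"] by simp
  obtain C1 where C1: "C1 > 0" "\<And>n. norm (qpoch q q n) \<le> C1"
    using qpoch_bounded[OF q] by blast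
  obtain C2 where C2: "C2 > 0" "\<And>n. norm (inverse (qpoch q q n)) \<le> C2"
    using inverse_qpoch_bounded[OF q nzq] by blast
  obtain C3 where C3: "C3 > 0" "\<And>n. norm (inverse (qpoch (x\<^sup>2) q n)) \<le> C3"
    using inverse_qpoch_bounded[OF q nz1] by blast
  obtain C4 where C4: "C4 > 0" "\<And>n. norm (inverse (qpoch (q / x\<^sup>2) q n)) \<le> C4"
    using inverse_qpoch_bounded[OF q nz2] by blast
  \<comment> \<open>Limit of \<open>R N (N + k)\<close> for fixed k, where all indices of the finite
    products tend to infinity.\<close>
  define L where "L = qpoch_inf q q * inverse (qpoch_inf q q) * inverse (qpoch_inf q q) *
     inverse (qpoch_inf (x\<^sup>2) q) * inverse (qpoch_inf (q / x\<^sup>2) q)"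
  have Lnz: "qpoch_inf q q \<noteq> 0" "qpoch_inf (x\<^sup>2) q \<noteq> 0" "qpoch_inf (q / x\<^sup>2) q \<noteq> 0"
    using qpoch_inf_nonzero[OF q] nzq nz1 nz2 by blast+
  define R where "R N m = qpoch q q (2 * N) * inverse (qpoch q q m) * inverse (qpoch q q (2 * N -
      m)) *
     inverse (qpoch (x\<^sup>2) q (Suc m)) * inverse (qpoch (q / x\<^sup>2) q (2 * N - m))" for N m
  define T where "T k N = (if - int N \<le> k \<and> k \<le>
      int N then quintuple_term q x k * R N (nat (int N + k)) else 0)" for k N
  have R_le: "norm (R N m) \<le> C1 * C2 * C2 * C3 * C4" for N m
    unfolding R_def norm_mult using C1 C2 C3 C4 by (intro mult_mono) auto
  have T_le: "norm (T k N) \<le> norm (quintuple_term q x k) * (C1 * C2 * C2 * C3 * C4)" for k N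
    using R_le C1 C2 C3 C4 by (auto simp: T_def norm_mult intro!: mult_left_mono)
  have T_lim: "T k \<longlonglongrightarrow> quintuple_term q x k * L" for k
  proof -
    have "filterlim (\<lambda>N. nat (int N + k)) at_top sequentially"
      "filterlim (\<lambda>N. 2 * N - nat (int N + k)) at_top sequentially"
      "filterlim (\<lambda>N. 2 * N) at_top sequentially"
      "filterlim (\<lambda>N. Suc (nat (int N + k))) at_top sequentially"
    proof -
      have *: "filterlim f at_top sequentially" if "\<And>Z N. Z + nat \<bar>k\<bar> \<le> N \<Longrightarrow> Z \<le>
          f N" for f :: "nat \<Rightarrow> nat"
        unfolding filterlim_at_top eventually_sequentially using that by blast
      show "filterlim (\<lambda>N. nat (int N + k)) at_top sequentially"
        "filterlim (\<lambda>N. 2 * N - nat (int N + k)) at_top sequentially"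
        "filterlim (\<lambda>N. 2 * N) at_top sequentially"
        "filterlim (\<lambda>N. Suc (nat (int N + k))) at_top sequentially"
        by (rule *, linarith)+
    qed
    then have "(\<lambda>N. R N (nat (int N + k))) \<longlonglongrightarrow> L"
      unfolding R_def L_def
      by (intro tendsto_intros filterlim_compose[OF qpoch_tendsto[OF q]] Lnz)
    then have "(\<lambda>N. quintuple_term q x k * R N (nat (int N + k))) \<longlonglongrightarrow> quintuple_term q x k * L"
      by (rule tendsto_mult_left)
    then show ?thesis
    proof (rule Lim_transform_eventually)
      show "\<forall>\<^sub>F N in sequentially. quintuple_term q x k * R N (nat (int N + k)) = T k N"
        using eventually_ge_at_top[of "nat \<bar>k\<bar>"] by eventually_elim (auto simp: T_def)
    qed
  qed
  have T_sum: "(\<Sum>\<^sub>\<infinity>k. T k N) = 1 / (qpoch x q (Suc N) * qpoch (q / x) q N)" for N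
  proof (rule infsumI)
    have "((\<lambda>k. T k N) has_sum (\<Sum>k\<in>{- int N..int N}. T k N)) UNIV"
      by (rule has_sum_finite_neutralI[of "{- int N..int N}"]) (auto simp: T_def)
    also have "(\<Sum>k\<in>{- int N..int N}. T k N) = (\<Sum>m\<le>2 * N. T (int m - int N) N)"
      by (rule sum.reindex_bij_witness[of _ "\<lambda>m. int m - int N" "\<lambda>k. nat (k + int N)"]) auto
    also have "\<dots> = (\<Sum>m\<le>2 * N. qpoch q q (2 * N) * (quintuple_term q x (int m - int N) /
        (qpoch q q m * qpoch q q (2 * N - m)
       * qpoch (x\<^sup>2) q (Suc m) * qpoch (q / x\<^sup>2) q (2 * N - m))))"
      by (intro sum.cong refl) (auto simp: T_def R_def divide_inverse mult_ac)
    also have "\<dots> = 1 / (qpoch x q (Suc N) * qpoch (q / x) q N)"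
      unfolding sum_distrib_left[symmetric] quintuple_fin[OF x nz]
      using qpoch_qq_nonzero[OF q] by simp
    finally show "((\<lambda>k. T k N) has_sum 1 / (qpoch x q (Suc N) * qpoch (q / x) q N)) UNIV" .
  qed
  have s: "quintuple_term q x summable_on UNIV"
    using quintuple_term_summable[OF x] by (rule abs_summable_summable)
  \<comment> \<open>Tannery's theorem concerns series over the naturals, so the integers are
    enumerated by \<open>int_decode\<close>. Extending the terms \<open>T\<close> by 0 beyond |k| =
    N gives every finite identity the same index set.\<close>
  have M: "summable (\<lambda>n. norm (quintuple_term q x (int_decode n)) * (C1 * C2 * C2 * C3 * C4))"
    using summable_on_reindex_bij_betw[OF bij_int_decode, of "\<lambda>k. norm (quintuple_term q x k)"]
      quintuple_term_summable[OF x]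
    by (intro summable_mult2 summable_on_imp_summable) simp
  have suminf_T: "(\<Sum>n. T (int_decode n) N) = (\<Sum>\<^sub>\<infinity>k. T k N)" for N
  proof -
    have "(\<lambda>k. T k N) summable_on UNIV"
      by (rule finite_nonzero_values_imp_summable_on, rule finite_subset[of _ "{- int N..int N}"])
         (auto simp: T_def)
    then have "((\<lambda>n. T (int_decode n) N) has_sum (\<Sum>\<^sub>\<infinity>k. T k N)) UNIV"
      using has_sum_reindex_bij_betw[OF bij_int_decode, of "\<lambda>k. T k N"] by simp
    then show ?thesis
      using has_sum_imp_sums sums_unique by metis
  qed
  have lim: "(\<lambda>N. \<Sum>n. T (int_decode n) N) \<longlonglongrightarrow> (\<Sum>n. quintuple_term q x (int_decode n) * L)"
    using tannerys_theorem[of "\<lambda>n N. T (int_decode n) N" "\<lambda>n. quintuple_term q x (int_decode n) * L" sequentially,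
        OF T_lim _ M] T_le by (auto intro!: always_eventually)
  have "(\<lambda>N. 1 / (qpoch x q (Suc N) * qpoch (q / x) q N)) \<longlonglongrightarrow> 1 / (qpoch_inf x q * qpoch_inf (q /
      x) q)"
    using nz3 by (intro tendsto_intros LIMSEQ_Suc qpoch_tendsto q) auto
  with lim have eq: "(\<Sum>n. quintuple_term q x (int_decode n) * L) =
      1 / (qpoch_inf x q * qpoch_inf (q / x) q)"
    unfolding suminf_T T_sum using LIMSEQ_unique by blast
  have "((\<lambda>k. quintuple_term q x k * L) has_sum infsum (quintuple_term q x) UNIV * L) UNIV"
    by (intro has_sum_cmult_left has_sum_infsum s)
  then have "((\<lambda>n. quintuple_term q x (int_decode n) * L)
      has_sum infsum (quintuple_term q x) UNIV * L) UNIV"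
    using has_sum_reindex_bij_betw[OF bij_int_decode, of "\<lambda>k. quintuple_term q x k * L"] by simp
  then have "infsum (quintuple_term q x) UNIV * L = 1 / (qpoch_inf x q * qpoch_inf (q / x) q)"
    unfolding eq[symmetric] using has_sum_imp_sums sums_unique by blast
  then have "infsum (quintuple_term q x) UNIV = ?rhs"
    using Lnz nz3 by (simp add: L_def field_simps)
  then show ?thesis
    using has_sum_infsum[OF s] by simp
qed

end

section \<open>Double sums\<close>

lemma qpoch_inf_square:
  assumes q: "norm q < 1"
  shows "qpoch_inf (z\<^sup>2) (q\<^sup>2) = qpoch_inf z q * qpoch_inf (- z) q"
proof (rule LIMSEQ_unique)
  have "norm (q\<^sup>2) < 1"
    using q by (simp add: norm_power power_less_one_iff)
  then show "qpoch (z\<^sup>2) (q\<^sup>2) \<longlonglongrightarrow> qpoch_inf (z\<^sup>2) (q\<^sup>2)"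
    by (rule qpoch_tendsto)
  have "qpoch (z\<^sup>2) (q\<^sup>2) n = qpoch z q n * qpoch (- z) q n" for n
    by (induction n) (simp_all add: qpoch_Suc power_mult[symmetric] mult.commute[of 2] power_mult power2_eq_square algebra_simps)
  then show "qpoch (z\<^sup>2) (q\<^sup>2) \<longlonglongrightarrow> qpoch_inf z q * qpoch_inf (- z) q"
    using tendsto_mult[OF qpoch_tendsto[OF q, of z] qpoch_tendsto[OF q, of "- z"]] by presburger
qed

lemma has_sum_parity_parts:
  fixes c :: "nat \<Rightarrow> complex"
  assumes "(c has_sum s) UNIV" "((\<lambda>m. (- 1) ^ m * c m) has_sum t) UNIV"
  shows "((\<lambda>j. c (2 * j)) has_sum (s + t) / 2) UNIV" "((\<lambda>j. c (2 * j + 1))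
      has_sum (s - t) / 2) UNIV"
proof -
  have "((\<lambda>m. 1 / 2 * (c m + (- 1) ^ m * c m)) has_sum 1 / 2 * (s + t)) UNIV"
    by (intro has_sum_cmult_right has_sum_add assms)
  also have "?this \<longleftrightarrow> (c has_sum 1 / 2 * (s + t)) (range (\<lambda>j. 2 * j))"
  proof (rule has_sum_cong_neutral)
    fix m assume "m \<in> UNIV - range (\<lambda>j. 2 * j :: nat)"
    then have "odd m" by (metis DiffD2 evenE rangeI)
    then show "1 / 2 * (c m + (- 1) ^ m * c m) = 0" by simp
  qed auto
  also have "\<dots> \<longleftrightarrow> ((\<lambda>j. c (2 * j)) has_sum 1 / 2 * (s + t)) UNIV"
    by (subst has_sum_reindex) (auto simp: inj_on_def o_def)
  finally show "((\<lambda>j. c (2 * j)) has_sum (s + t) / 2) UNIV"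
    by simp
  have "((\<lambda>m. 1 / 2 * (c m - (- 1) ^ m * c m)) has_sum 1 / 2 * (s - t)) UNIV"
    by (intro has_sum_cmult_right has_sum_diff assms)
  also have "?this \<longleftrightarrow> (c has_sum 1 / 2 * (s - t)) (range (\<lambda>j. 2 * j + 1))"
  proof (rule has_sum_cong_neutral)
    fix m assume "m \<in> UNIV - range (\<lambda>j. 2 * j + 1 :: nat)"
    then have "even m" by (metis (mono_tags, lifting) DiffD2 oddE rangeI)
    then show "1 / 2 * (c m - (- 1) ^ m * c m) = 0" by simp
  qed auto
  also have "\<dots> \<longleftrightarrow> ((\<lambda>j. c (2 * j + 1)) has_sum 1 / 2 * (s - t)) UNIV"
    by (subst has_sum_reindex) (auto simp: inj_on_def o_def)
  finally show "((\<lambda>j. c (2 * j + 1)) has_sum (s - t) / 2) UNIV"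
    by simp
qed

context
  fixes q :: complex
  assumes q: "norm q < 1" and q0: "q \<noteq> 0"
begin

text \<open>Both parity parts of Euler's expansion of \<open>qpoch_inf (- 1 / q ^ i) q\<close> are equal, because
  the alternating series sums to \<open>qpoch_inf (1 / q ^ i) q = 0\<close>.\<close>

lemma Euler_parity_parts:
  fixes i :: nat
  defines "V \<equiv> qpoch (- q) q i * qpoch_inf (- q) q / q ^ (i * (i + 1) div 2)"
  shows "((\<lambda>j. q powi (2 * (int j)\<^sup>2 - int j - 2 * int i * int j) / qpoch q q (2 * j))
      has_sum V) UNIV"
    and "((\<lambda>j. q powi (2 * (int j)\<^sup>2 + int j - 2 * int i * int j - int i) / qpoch q q (2 * j + 1))
      has_sum V) UNIV"
proof -
  define c where "c = phi_term q 0 (- 1 / q ^ i)"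
  have q00: "qpoch 0 q m = 1" "qpoch_inf 0 q = 1" for m
    by (simp_all add: qpoch_def qpoch_inf_def)
  have s: "(phi_term q 0 b has_sum qpoch_inf b q) UNIV" for b
    using phi_has_sum[OF q, of 0 b] by (simp add: q00)
  have c: "c m = q powi (int (m * (m - 1) div 2) - int i * int m) / qpoch q q m" for m
  proof -
    have "c m = q powi int (m * (m - 1) div 2) / q powi (int (i * m)) / qpoch q q m"
      unfolding power_int_of_nat by (simp add: c_def phi_term_def q00 power_divide power_mult)
    then show ?thesis
      using q0 by (simp add: power_int_diff)
  qed
  have "qpoch_inf (1 / q ^ i) q = 0"
    by (rule qpoch_inf_eq_0[OF q, of _ i]) (simp add: q0)
  then have "(phi_term q 0 (1 / q ^ i) has_sum 0) UNIV"
    using s[of "1 / q ^ i"] by simp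
  moreover have "phi_term q 0 (1 / q ^ i) = (\<lambda>m. (- 1) ^ m * c m)"
    unfolding c_def phi_term_def power_minus[of "1 / q ^ i"] by (simp add: fun_eq_iff)
  ultimately have alt: "((\<lambda>m. (- 1) ^ m * c m) has_sum 0) UNIV"
    by simp
  \<comment> \<open>The 2 is the factor 1 + q^0, reached after the first i factors; it compensates
    the halving in the parity parts.\<close>
  have "qpoch_inf (- 1 / q ^ i) q = 2 * V"
    using qpoch_inf_split[OF q, of "- 1 / q ^ i" i] qpoch_inf_split[OF q, of "- 1" 1]
      qpoch_reverse[of "- 1" q i] q0
    by (simp add: V_def qpoch_Suc)
  then have "(c has_sum 2 * V) UNIV"
    using s unfolding c_def by metis
  from has_sum_parity_parts[OF this alt]
  have 1: "((\<lambda>j. c (2 * j)) has_sum V) UNIV" "((\<lambda>j. c (2 * j + 1)) has_sum V) UNIV"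
    by simp_all
  have t: "int (2 * j * (2 * j - 1) div 2) - int i * int (2 * j) =
      2 * (int j)\<^sup>2 - int j - 2 * int i * int j"
    "int ((2 * j + 1) * (2 * j + 1 - 1) div 2) - int i * int (2 * j + 1)
      = 2 * (int j)\<^sup>2 + int j - 2 * int i * int j - int i" for j
  proof -
    have "2 * j * (2 * j - 1) div 2 = j * (2 * j - 1)" "(2 * j + 1) * (2 * j + 1 - 1) div 2 =
        (2 * j + 1) * j"
      by simp_all
    moreover have "int (j * (2 * j - 1)) = 2 * (int j)\<^sup>2 - int j"
      by (cases j) (auto simp: power2_eq_square algebra_simps)
    moreover have "int ((2 * j + 1) * j) = 2 * (int j)\<^sup>2 + int j"
      by (simp add: power2_eq_square algebra_simps)
    ultimately show "int (2 * j * (2 * j - 1) div 2) - int i * int (2 * j) =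
        2 * (int j)\<^sup>2 - int j - 2 * int i * int j"
    "int ((2 * j + 1) * (2 * j + 1 - 1) div 2) - int i * int (2 * j + 1)
      = 2 * (int j)\<^sup>2 + int j - 2 * int i * int j - int i"
      by (simp_all add: algebra_simps)
  qed
  from 1 show "((\<lambda>j. q powi (2 * (int j)\<^sup>2 - int j - 2 * int i * int j) / qpoch q q (2 * j))
      has_sum V) UNIV"
    and "((\<lambda>j. q powi (2 * (int j)\<^sup>2 + int j - 2 * int i * int j - int i) / qpoch q q (2 * j + 1))
      has_sum V) UNIV"
    unfolding c t .
qed

text \<open>The bound on the exponent dominates the terms by a product of two geometric series. The
  resulting absolute summability turns the iterated sum into an unordered sum over pairs.\<close>

lemma double_has_sum:
  assumes e: "\<And>i j. int i + int j - 1 \<le> e i j"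
    and inner: "\<And>i. ((\<lambda>j. q powi e i j / (qpoch q q (f i) * qpoch q q (h j))) has_sum G i) UNIV"
    and outer: "(G has_sum S) UNIV"
  shows "((\<lambda>(i, j). q powi e i j / (qpoch q q (f i) * qpoch q q (h j)))
      has_sum S) (UNIV :: (nat \<times> nat) set)"
proof -
  obtain C where C: "C > 0" "\<And>n. norm (inverse (qpoch q q n)) \<le> C"
    using inverse_qpoch_bounded[OF q, of q] power_q_neq_1[OF q, of "Suc _"] by auto
  have "(\<lambda>(i, j). norm q ^ i * norm q ^ j) summable_on (UNIV :: nat set) \<times> (UNIV :: nat set)"
    using q by (intro summable_on_times) (auto intro!: summable_nonneg_imp_summable_on summable_geometric)
  then have "(\<lambda>p. C * C / norm q * (case p of (i, j) \<Rightarrow> norm q ^ i * norm q ^ j))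
      summable_on (UNIV :: nat set) \<times> (UNIV :: nat set)"
    by (rule summable_on_cmult_right)
  then have "(\<lambda>p. norm (case p of (i, j) \<Rightarrow> q powi e i j / (qpoch q q (f i) * qpoch q q (h j))))
      summable_on (UNIV :: nat set) \<times> (UNIV :: nat set)"
  proof (rule Infinite_Sum.abs_summable_on_comparison_test')
    fix p :: "nat \<times> nat"
    obtain i j where p: "p = (i, j)" by force
    have "norm (q powi e i j) \<le> norm q powi (int i + int j - 1)"
      by (rule norm_powi_le[OF q q0 e])
    also have "\<dots> = norm q ^ i * norm q ^ j / norm q"
      using q0 by (simp add: power_int_add power_int_diff)
    finally have "norm (q powi e i j) * (norm (inverse (qpoch q q (f i))) * norm (inverse (qpoch q q (h j))))
      \<le> (norm q ^ i * norm q ^ j / norm q) * (C * C)"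
      using C by (intro mult_mono) auto
    then show "norm (case p of (i, j) \<Rightarrow> q powi e i j / (qpoch q q (f i) * qpoch q q (h j)))
        \<le> C * C / norm q * (case p of (i, j) \<Rightarrow> norm q ^ i * norm q ^ j)"
      by (simp add: p norm_mult norm_divide norm_inverse divide_inverse mult_ac)
  qed
  then have "(\<lambda>(i, j). q powi e i j / (qpoch q q (f i) * qpoch q q (h j)))
      summable_on (UNIV :: nat set) \<times> (UNIV :: nat set)"
    by (rule abs_summable_summable)
  then have "((\<lambda>(i, j). q powi e i j / (qpoch q q (f i) * qpoch q q (h j)))
      has_sum S) (UNIV \<times> UNIV)"
    using inner outer by (intro has_sum_SigmaI[where g = G]) auto
  then show ?thesis by simp
qed

end

text \<open>The first difference is (i - j)^2 + (j - 1)^2 + si. The second is, up to the constant 1,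
  a sum of products m(m - 1), which are nonnegative because m is an integer.\<close>

lemma exponent_bounds:
  fixes i j s :: nat
  shows "int i + int j - 1 \<le> (int i)\<^sup>2 -
      2 * int i * int j + 2 * (int j)\<^sup>2 + (int s + 1) * int i - int j"
    and "int i + int j - 1 \<le> (int i)\<^sup>2 - 2 * int i * int j + 2 * (int j)\<^sup>2 + int s * int i + int j"
proof -
  have "0 \<le> (int i - int j)\<^sup>2 + (int j - 1)\<^sup>2 + int s * int i" by simp
  then show "int i + int j - 1 \<le> (int i)\<^sup>2 -
      2 * int i * int j + 2 * (int j)\<^sup>2 + (int s + 1) * int i - int j"
    by (simp add: power2_eq_square algebra_simps)
  have *: "0 \<le> m * (m - 1)" for m :: int
    by (cases "m \<le> 0") (auto intro: mult_nonpos_nonpos mult_nonneg_nonneg)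
  have "0 \<le> (int i - int j) * (int i - int j - 1) + int j * (int j - 1) + int s * int i"
    using *[of "int i - int j"] *[of "int j"] by simp
  then show "int i + int j - 1 \<le> (int i)\<^sup>2 -
      2 * int i * int j + 2 * (int j)\<^sup>2 + int s * int i + int j"
    by (simp add: power2_eq_square algebra_simps)
qed

context
  fixes q :: complex
  assumes q: "norm q < 1" and q0: "q \<noteq> 0"
begin

text \<open>For fixed i the power q^(i(i+1) + si) factors out, and the denominator q^(i(i+1)/2) of
  Euler's parity parts leaves the triangular exponent of the single sum. The -i in the odd part
  turns (s + 1)i into si, which explains the different exponents of the two double sums.\<close>

lemma double_has_sum_parity:
  assumes outer: "((\<lambda>i. qpoch (- q) q i * q ^ (i * (i + 1) div 2) * (q ^ (s * i) /
      qpoch q q (f i))) has_sum S) UNIV"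
  shows "((\<lambda>(i, j). q powi ((int i)\<^sup>2 - 2 * int i * int j + 2 * (int j)\<^sup>2 + (int s + 1) * int i -
      int j)
      / (qpoch q q (f i) * qpoch q q (2 * j)))
          has_sum qpoch_inf (- q) q * S) (UNIV :: (nat \<times> nat) set)"
    and "((\<lambda>(i, j). q powi ((int i)\<^sup>2 - 2 * int i * int j + 2 * (int j)\<^sup>2 + int s * int i + int j)
      / (qpoch q q (f i) * qpoch q q (2 * j + 1)))
          has_sum qpoch_inf (- q) q * S) (UNIV :: (nat \<times> nat) set)"
proof -
  define G where "G i = qpoch_inf (- q) q * (qpoch (- q) q i * q ^ (i * (i + 1) div 2) * (q ^ (s * i) / qpoch q q (f i)))" for i
  define A where "A i = (int i)\<^sup>2 + (int s + 1) * int i" for i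
  have G: "(G has_sum qpoch_inf (- q) q * S) UNIV"
    unfolding G_def by (rule has_sum_cmult_right[OF outer])
  have GA: "G i = q powi A i / qpoch q q (f i) * (qpoch (- q) q i * qpoch_inf (- q) q /
      q ^ (i * (i + 1) div 2))" for i
  proof -
    have "i * (i + 1) div 2 + i * (i + 1) div 2 = i * (i + 1)"
      using two_times_triangle[of i] unfolding mult_2 .
    then have "i * i + (s + 1) * i = i * (i + 1) div 2 + i * (i + 1) div 2 + s * i"
      by (simp only: add_mult_distrib distrib_left mult_1_left mult_1_right add.assoc add.commute add.left_commute mult.commute)
    then have "q ^ (i * i + (s + 1) * i) =
        q ^ (i * (i + 1) div 2) * q ^ (i * (i + 1) div 2) * q ^ (s * i)"
      by (simp only: power_add)
    moreover have "A i = int (i * i + (s + 1) * i)"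
      by (simp add: A_def power2_eq_square algebra_simps)
    ultimately have "q powi A i = q ^ (i * (i + 1) div 2) * q ^ (i * (i + 1) div 2) * q ^ (s * i)"
      by (simp only: power_int_of_nat)
    then show ?thesis
      using q0 by (simp add: G_def)
  qed
  show "((\<lambda>(i, j). q powi ((int i)\<^sup>2 - 2 * int i * int j + 2 * (int j)\<^sup>2 + (int s + 1) * int i -
      int j)
      / (qpoch q q (f i) * qpoch q q (2 * j)))
          has_sum qpoch_inf (- q) q * S) (UNIV :: (nat \<times> nat) set)"
  proof (rule double_has_sum[OF q q0 exponent_bounds(1) _ G])
    fix i
    have "q powi A i / qpoch q q (f i) * (q powi (2 * (int j)\<^sup>2 - int j - 2 * int i * int j) /
        qpoch q q (2 * j)) =
      q powi ((int i)\<^sup>2 - 2 * int i * int j + 2 * (int j)\<^sup>2 + (int s + 1) * int i - int j)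
      / (qpoch q q (f i) * qpoch q q (2 * j))" for j
    proof -
      have "A i + (2 * (int j)\<^sup>2 - int j - 2 * int i * int j) =
        (int i)\<^sup>2 - 2 * int i * int j + 2 * (int j)\<^sup>2 + (int s + 1) * int i - int j"
        by (simp add: A_def)
      then show ?thesis
        using power_int_add[of q "A i"] q0 by (metis times_divide_times_eq)
    qed
    then show "((\<lambda>j. q powi ((int i)\<^sup>2 -
        2 * int i * int j + 2 * (int j)\<^sup>2 + (int s + 1) * int i - int j)
      / (qpoch q q (f i) * qpoch q q (2 * j))) has_sum G i) UNIV"
      using has_sum_cmult_right[OF Euler_parity_parts(1)[OF q q0, of i], of "q powi A i /
          qpoch q q (f i)"]
      unfolding GA by presburger
  qed
  show "((\<lambda>(i, j). q powi ((int i)\<^sup>2 - 2 * int i * int j + 2 * (int j)\<^sup>2 + int s * int i + int j)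
      / (qpoch q q (f i) * qpoch q q (2 * j + 1)))
          has_sum qpoch_inf (- q) q * S) (UNIV :: (nat \<times> nat) set)"
  proof (rule double_has_sum[OF q q0 exponent_bounds(2) _ G])
    fix i
    have "q powi A i / qpoch q q (f i) * (q powi (2 * (int j)\<^sup>2 + int j - 2 * int i * int j -
        int i) / qpoch q q (2 * j + 1)) =
      q powi ((int i)\<^sup>2 - 2 * int i * int j + 2 * (int j)\<^sup>2 + int s * int i + int j)
      / (qpoch q q (f i) * qpoch q q (2 * j + 1))" for j
    proof -
      have "A i + (2 * (int j)\<^sup>2 + int j - 2 * int i * int j - int i) =
        (int i)\<^sup>2 - 2 * int i * int j + 2 * (int j)\<^sup>2 + int s * int i + int j"
        by (simp add: A_def algebra_simps)
      then show ?thesis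
        using power_int_add[of q "A i"] q0 by (metis times_divide_times_eq)
    qed
    then show "((\<lambda>j. q powi ((int i)\<^sup>2 - 2 * int i * int j + 2 * (int j)\<^sup>2 + int s * int i + int j)
      / (qpoch q q (f i) * qpoch q q (2 * j + 1))) has_sum G i) UNIV"
      using has_sum_cmult_right[OF Euler_parity_parts(2)[OF q q0, of i], of "q powi A i /
          qpoch q q (f i)"]
      unfolding GA by presburger
  qed
qed

section \<open>Theta series as quintuple products in base q^7\<close>

lemma powi_summable:
  assumes e: "\<And>k. \<bar>k\<bar> - L \<le> e k"
  shows "(\<lambda>k. q powi e k) summable_on UNIV"
proof (rule abs_summable_summable, rule Infinite_Sum.abs_summable_on_comparison_test')
  show "(\<lambda>k. norm q powi (- L) * norm q ^ nat \<bar>k\<bar>) summable_on UNIV"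
    using q by (intro summable_on_cmult_right summable_on_int_geometric) auto
  fix k
  have "norm (q powi e k) \<le> norm q powi (- L + int (nat \<bar>k\<bar>))"
    by (rule norm_powi_le[OF q q0]) (use e[of k] in simp)
  also have "\<dots> = norm q powi (- L) * norm q ^ nat \<bar>k\<bar>"
    using power_int_add[of "norm q" "- L" "int (nat \<bar>k\<bar>)"] q0 unfolding power_int_of_nat by simp
  finally show "norm (q powi e k) \<le> norm q powi (- L) * norm q ^ nat \<bar>k\<bar>" .
qed

lemma powi_neq_1: "m \<noteq> 0 \<Longrightarrow> q powi m \<noteq> 1"
  using powi_not_1[OF q, of m] powi_not_1[OF q, of "- m"] q0
  by (cases "0 < m") (auto simp: power_int_minus)

text \<open>The quintuple product identity at base q^7 and x = -q^a: the signs (-1)^k and (-1)^(3k)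
  cancel. On the product side, splitting (x^2) and (q^7/x^2) by parity and factoring squares removes
  both denominators. Exponents are given doubled to avoid \<open>div\<close>.\<close>

lemma theta_quintuple:
  assumes a: "a \<in> {1, 2, 3}"
    and E1: "\<And>k. 2 * E1 k = 21 * k\<^sup>2 + (6 * int a - 7) * k"
    and E2: "\<And>k. 2 * E2 k = 21 * k\<^sup>2 + (6 * int a + 7) * k + 2 * int a"
  shows "(\<Sum>\<^sub>\<infinity>k. q powi E1 k) - (\<Sum>\<^sub>\<infinity>k. q powi E2 k) =
    qpoch_inf (q ^ 7) (q ^ 7) * qpoch_inf (q ^ a) (q ^ 7) * qpoch_inf (q ^ (7 - a)) (q ^ 7) *
    qpoch_inf (q ^ (7 + 2 * a)) (q ^ 14) * qpoch_inf (q ^ (7 - 2 * a)) (q ^ 14)"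
proof -
  define Q where "Q = q ^ 7"
  define z where "z = q ^ a"
  have Q: "norm Q < 1" "Q \<noteq> 0" and z: "z \<noteq> 0"
    using q q0 by (simp_all add: Q_def z_def norm_power power_less_one_iff)
  have a': "1 \<le> a" "a \<le> 3"
    using a by auto
  have nz: "(- z)\<^sup>2 * Q powi k \<noteq> 1" for k
  proof -
    have "(- z)\<^sup>2 * Q powi k = q powi (2 * int a) * q powi (7 * k)"
      by (simp add: z_def Q_def power_int_mult power_mult[symmetric] mult.commute power_int_power)
    also have "\<dots> = q powi (2 * int a + 7 * k)"
      using q0 by (simp add: power_int_add)
    \<comment> \<open>Since 7 does not divide 2a for a = 1, 2, 3, the exponent 2a + 7k is never
      0.\<close>
    finally show ?thesis
      using powi_neq_1[of "2 * int a + 7 * k"] a by (auto; presburger)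
  qed
  have qt: "quintuple_term Q (- z) k = q powi E1 k - q powi E2 k" for k
  proof -
    have tk: "2 * (k * (k - 1) div 2) = k * (k - 1)"
      by simp
    define t where "t = k * (k - 1) div 2"
    have 1: "E1 k = int a * (3 * k) + 7 * (3 * t + k)"
      using E1[of k] tk unfolding t_def[symmetric] by (simp add: power2_eq_square algebra_simps)
    have 2: "E2 k = E1 k + (int a + 7 * k)"
      using E1[of k] E2[of k] by (simp add: algebra_simps)
    have zp: "z powi n = q powi (int a * n)" and Qp: "Q powi n = q powi (7 * n)" for n
      by (simp_all add: z_def Q_def power_int_mult)
    have "(- z) powi (3 * k) = (- 1) powi (3 * k) * z powi (3 * k)"
      using power_int_mult_distrib[of "- 1" z "3 * k"] by simp
    moreover have "(- 1 :: complex) powi k * (- 1) powi (3 * k) = 1"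
    proof -
      have "(- 1 :: complex) powi k * (- 1) powi (3 * k) = (- 1) powi (2 * (2 * k))"
        by (subst power_int_add[symmetric]) simp_all
      also have "\<dots> = 1"
        by (subst power_int_mult) simp
      finally show ?thesis .
    qed
    moreover have "quintuple_term Q (- z) k =
        (- 1) powi k * (- z) powi (3 * k) * (1 - z * Q powi k) * Q powi (3 * t + k)"
      by (simp add: quintuple_term_def t_def)
    ultimately have "quintuple_term Q (- z) k =
        z powi (3 * k) * Q powi (3 * t + k) * (1 - z * Q powi k)"
      by (simp add: mult_ac)
    also have "z powi (3 * k) * Q powi (3 * t + k) = q powi E1 k"
      unfolding zp Qp 1 by (simp only: power_int_add[OF disjI1, OF q0])
    also have "z * Q powi k = q powi (int a + 7 * k)"
      unfolding Qp by (simp add: z_def power_int_add q0)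
    also have "q powi E1 k * (1 - q powi (int a + 7 * k)) = q powi E1 k - q powi E2 k"
      unfolding 2 power_int_add[OF disjI1, OF q0] by (simp add: algebra_simps)
    finally show ?thesis .
  qed
  have sq: "\<bar>k\<bar> \<le> k\<^sup>2" for k :: int
  proof (cases "k = 0")
    case False
    then have "\<bar>k\<bar> * 1 \<le> \<bar>k\<bar> * \<bar>k\<bar>"
      by (intro mult_left_mono) auto
    then show ?thesis by (simp add: power2_eq_square)
  qed simp
  \<comment> \<open>The constants 11 and 25 are 6a - 7 and 6a + 7 at a = 3.\<close>
  have b: "(6 * int a - 7) * k \<ge> - 11 * \<bar>k\<bar>" "(6 * int a + 7) * k \<ge> - 25 * \<bar>k\<bar>" for k
    using a by (auto simp: abs_if)
  have s1: "(\<lambda>k. q powi E1 k) summable_on UNIV"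
    by (rule powi_summable[of 0]) (use E1 b(1) sq in \<open>smt (verit)\<close>)
  have s2: "(\<lambda>k. q powi E2 k) summable_on UNIV"
  proof (rule powi_summable[of 10])
    fix k :: int
    have "0 \<le> (\<bar>k\<bar> - 1)\<^sup>2"
      by (rule zero_le_power2)
    then have "2 * \<bar>k\<bar> \<le> k\<^sup>2 + 1"
      by (simp add: power2_eq_square algebra_simps)
    then show "\<bar>k\<bar> - 10 \<le> E2 k"
      using E2[of k] b(2)[of k] sq[of k] a' by linarith
  qed
  have "(\<Sum>\<^sub>\<infinity>k. q powi E1 k) - (\<Sum>\<^sub>\<infinity>k. q powi E2 k) = infsum (quintuple_term Q (- z)) UNIV"
    by (rule infsumI[symmetric]) (unfold qt, intro has_sum_diff has_sum_infsum s1 s2)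
  also have "\<dots> = qpoch_inf Q Q * qpoch_inf ((- z)\<^sup>2) Q * qpoch_inf (Q / (- z)\<^sup>2) Q /
      (qpoch_inf (- z) Q * qpoch_inf (Q / (- z)) Q)"
    by (rule infsumI, rule quintuple_product) (use Q z nz in auto)
  also have "qpoch_inf ((- z)\<^sup>2) Q = qpoch_inf z Q * qpoch_inf (- z) Q * qpoch_inf (q ^ (7 + 2 * a)) (q ^ 14)"
  proof -
    have "qpoch_inf (z\<^sup>2) Q = qpoch_inf (z\<^sup>2) (Q\<^sup>2) * qpoch_inf (z\<^sup>2 * Q) (Q\<^sup>2)"
      using qpoch_inf_dissect[OF Q(1), of 2 "z\<^sup>2"] by (simp add: numeral_2_eq_2)
    also have "z\<^sup>2 * Q = q ^ (7 + 2 * a)"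
      by (simp add: z_def Q_def power_mult[symmetric] power_add mult.commute)
    also have "qpoch_inf (z\<^sup>2) (Q\<^sup>2) = qpoch_inf z Q * qpoch_inf (- z) Q"
      by (rule qpoch_inf_square[OF Q(1)])
    finally show ?thesis
      by (simp add: Q_def power_mult[symmetric])
  qed
  also have "qpoch_inf (Q / (- z)\<^sup>2) Q =
      qpoch_inf (Q / z) Q * qpoch_inf (Q / (- z)) Q * qpoch_inf (q ^ (7 - 2 * a)) (q ^ 14)"
  proof -
    have "qpoch_inf (Q / z\<^sup>2) Q = qpoch_inf (Q / z\<^sup>2) (Q\<^sup>2) * qpoch_inf (Q / z\<^sup>2 * Q) (Q\<^sup>2)"
      using qpoch_inf_dissect[OF Q(1), of 2 "Q / z\<^sup>2"] by (simp add: numeral_2_eq_2)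
    also have "Q / z\<^sup>2 * Q = (Q / z)\<^sup>2"
      by (simp add: power_divide power2_eq_square)
    also have "qpoch_inf ((Q / z)\<^sup>2) (Q\<^sup>2) = qpoch_inf (Q / z) Q * qpoch_inf (Q / (- z)) Q"
      using qpoch_inf_square[OF Q(1), of "Q / z"] by simp
    finally have *: "qpoch_inf (Q / z\<^sup>2) Q =
        qpoch_inf (Q / z\<^sup>2) (Q\<^sup>2) * (qpoch_inf (Q / z) Q * qpoch_inf (Q / (- z)) Q)" .
    have "Q / z\<^sup>2 = q ^ (7 - 2 * a)" "Q\<^sup>2 = q ^ 14"
      using a' q0 by (simp_all add: z_def Q_def power_mult[symmetric] power_diff mult.commute)
    with * show ?thesis
      by (simp only: power2_minus mult_ac)
  qed
  finally have "(\<Sum>\<^sub>\<infinity>k. q powi E1 k) - (\<Sum>\<^sub>\<infinity>k. q powi E2 k) =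
    qpoch_inf Q Q * (qpoch_inf z Q * qpoch_inf (- z) Q * qpoch_inf (q ^ (7 + 2 * a)) (q ^ 14)) *
    (qpoch_inf (Q / z) Q * qpoch_inf (Q / (- z)) Q * qpoch_inf (q ^ (7 - 2 * a)) (q ^ 14)) /
    (qpoch_inf (- z) Q * qpoch_inf (Q / (- z)) Q)" .
  moreover have "Q / z = q ^ (7 - a)"
    using a' q0 by (simp add: z_def Q_def power_diff)
  moreover have "qpoch_inf (- z) Q \<noteq> 0" "qpoch_inf (Q / (- z)) Q \<noteq> 0"
    using \<open>Q / z = q ^ (7 - a)\<close> a' q
    by (auto intro!: qpoch_inf_nonzero_norm_less[OF Q(1)]
        simp: z_def norm_power power_less_one_iff simp flip: minus_divide_right)
  ultimately show ?thesis
    by (simp add: Q_def[symmetric] z_def[symmetric] mult_ac)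
qed

end

section \<open>Products modulo 14\<close>

definition theta_prod :: "complex \<Rightarrow> nat \<Rightarrow> complex" where
  "theta_prod q a = qpoch_inf (q ^ 7) (q ^ 7) * qpoch_inf (q ^ a) (q ^ 7) * qpoch_inf (q ^ (7 -
      a)) (q ^ 7) *
    qpoch_inf (q ^ (7 + 2 * a)) (q ^ 14) * qpoch_inf (q ^ (7 - 2 * a)) (q ^ 14)"

text \<open>Euler's theorem that partitions into odd parts and into distinct parts are equinumerous,
  in product form.\<close>

lemma qpoch_inf_odd_times_qpoch_inf_minus:
  assumes q: "norm q < 1"
  shows "qpoch_inf q (q\<^sup>2) * qpoch_inf (- q) q = 1"
proof -
  have "qpoch_inf q q = qpoch_inf q (q\<^sup>2) * qpoch_inf (q\<^sup>2) (q\<^sup>2)"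
    using qpoch_inf_dissect[OF q, of 2 q] by (simp add: numeral_2_eq_2)
  also have "qpoch_inf (q\<^sup>2) (q\<^sup>2) = qpoch_inf q q * qpoch_inf (- q) q"
    by (rule qpoch_inf_square[OF q])
  finally show ?thesis
    using qpoch_inf_nonzero_norm_less[OF q q] by simp
qed

text \<open>Dissecting (q;q)_inf modulo 14 gives fourteen factors; \<open>theta_prod\<close> uses
  eight of these residue classes, and the list contains the other six.\<close>

lemma theta_prod_eq:
  assumes q: "norm q < 1"
  shows "theta_prod q 1 * qpoch_infs [q\<^sup>2, q ^ 3, q ^ 4, q ^ 10, q ^ 11, q ^ 12] (q ^ 14) =
      qpoch_inf q q"
    and "theta_prod q 2 * qpoch_infs [q, q ^ 4, q ^ 6, q ^ 8, q ^ 10, q ^ 13] (q ^ 14) =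
        qpoch_inf q q"
    and "theta_prod q 3 * qpoch_infs [q\<^sup>2, q ^ 5, q ^ 6, q ^ 8, q ^ 9, q ^ 12] (q ^ 14) =
        qpoch_inf q q"
proof -
  define p where "p n = qpoch_inf (q ^ n) (q ^ 14)" for n
  have "norm (q ^ 7) < 1"
    using q by (simp add: norm_power power_less_one_iff)
  then have "qpoch_inf (q ^ a) (q ^ 7) =
      qpoch_inf (q ^ a) ((q ^ 7) ^ 2) * qpoch_inf (q ^ a * q ^ 7) ((q ^ 7) ^ 2)" for a
    using qpoch_inf_dissect[of "q ^ 7" 2 "q ^ a"] by (simp add: numeral_2_eq_2)
  then have p7: "qpoch_inf (q ^ a) (q ^ 7) = p a * p (a + 7)" for a
    by (simp add: p_def power_mult[symmetric] power_add[symmetric])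
  have "qpoch_inf q q = (\<Prod>s<14. p (Suc s))"
    using qpoch_inf_dissect[OF q, of 14 q] by (simp add: p_def)
  also have "\<dots> = p 1 * p 2 * p 3 * p 4 * p 5 * p 6 * p 7 * p 8 * p 9 * p 10 * p 11 * p 12 * p 13 * p 14"
    by (simp add: eval_nat_numeral lessThan_Suc mult_ac)
  finally have pq: "qpoch_inf q q = \<dots>" .
  have p1: "qpoch_inf q (q ^ 14) = p 1"
    by (simp add: p_def)
  show "theta_prod q 1 * qpoch_infs [q\<^sup>2, q ^ 3, q ^ 4, q ^ 10, q ^ 11, q ^ 12] (q ^ 14) =
      qpoch_inf q q"
    "theta_prod q 2 * qpoch_infs [q, q ^ 4, q ^ 6, q ^ 8, q ^ 10, q ^ 13] (q ^ 14) = qpoch_inf q q"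
    "theta_prod q 3 * qpoch_infs [q\<^sup>2, q ^ 5, q ^ 6, q ^ 8, q ^ 9, q ^ 12] (q ^ 14) = qpoch_inf q q"
    unfolding theta_prod_def pq p7 qpoch_infs_def by (simp_all add: p1 p_def[symmetric] mult_ac)
qed

text \<open>One factor \<open>qpoch_inf (- q) q\<close> comes from the sum over j, the other from
  the Bailey kernel; each equals 1/(q;q^2)_inf.\<close>

lemma product_side:
  assumes q: "norm q < 1" and P: "P * R = qpoch_inf q q"
  shows "qpoch_inf (- q) q * (qpoch_inf (- q) q / qpoch_inf q q * P) =
      1 / ((qpoch_inf q (q\<^sup>2))\<^sup>2 * R)"
proof -
  have "qpoch_inf q q \<noteq> 0"
    by (rule qpoch_inf_nonzero_norm_less[OF q q])
  moreover from this have "R \<noteq> 0"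
    using P by auto
  moreover from this have "P = qpoch_inf q q / R"
    using P by (simp add: nonzero_eq_divide_eq)
  moreover have "qpoch_inf (- q) q = 1 / qpoch_inf q (q\<^sup>2)"
    using qpoch_inf_odd_times_qpoch_inf_minus[OF q]
        by (metis nonzero_eq_divide_eq mult.commute mult_zero_left zero_neq_one)
  ultimately show ?thesis
    by (simp add: power2_eq_square divide_inverse mult_ac)
qed

section \<open>Slater's single-sum identities\<close>

context
  fixes q :: complex
  assumes q: "norm q < 1" and q0: "q \<noteq> 0"
begin

text \<open>The two alternatives in \<open>E'\<close> allow the first theta series to be read
  backwards: for u = -1 its doubled exponent is 21k^2 + k, whereas a = 1 requires 21k^2 - k.\<close>

lemma Bailey_pair_sum:
  assumes pair: "\<And>n. theta_fin q u (int n) (int n + 1) - q ^ l * theta_fin q v (int n -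
      c) (int n + c + 1) = \<beta> n"
    and a: "a \<in> {1, 2, 3}"
    and E: "\<And>k. 2 * E k = 21 * k\<^sup>2 + (6 * int a - 7) * k"
    and E': "E = (\<lambda>k. 6 * k\<^sup>2 + u * k + 3 * k * (3 * k + 1) div 2) \<or>
              E = (\<lambda>k. 6 * (- k)\<^sup>2 + u * (- k) + 3 * (- k) * (3 * (- k) + 1) div 2)"
    and F: "\<And>k. 2 * (int l + (6 * k\<^sup>2 + v * k + (3 * k + c) * (3 * k + c + 1) div 2))
       = 21 * k\<^sup>2 + (6 * int a + 7) * k + 2 * int a"
  shows "((\<lambda>n. qpoch (- q) q n * q ^ (n * (n + 1) div 2) * \<beta> n)
    has_sum qpoch_inf (- q) q / qpoch_inf q q * theta_prod q a) UNIV"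
proof -
  define K where "K = qpoch_inf (- q) q / qpoch_inf q q"
  define e2 where "e2 k = 6 * k\<^sup>2 + v * k + (3 * k + c) * (3 * k + c + 1) div 2" for k
  have 1: "(\<Sum>\<^sub>\<infinity>k. q powi (6 * k\<^sup>2 + u * k + 3 * k * (3 * k + 1) div 2)) = (\<Sum>\<^sub>\<infinity>k. q powi E k)"
    using E'
  proof
    assume "E = (\<lambda>k. 6 * (- k)\<^sup>2 + u * (- k) + 3 * (- k) * (3 * (- k) + 1) div 2)"
    then show ?thesis
      by (intro infsum_reindex_bij_witness[of _ uminus uminus]) (auto simp: add.commute)
  qed simp
  have 2: "(\<Sum>\<^sub>\<infinity>k. q powi (int l + e2 k)) = q ^ l * (\<Sum>\<^sub>\<infinity>k. q powi e2 k)"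
    by (simp only: power_int_add[OF disjI1, OF q0] infsum_cmult_right' power_int_of_nat)
  have "((\<lambda>n. qpoch (- q) q n * q ^ (n * (n + 1) div 2) * theta_fin q u (int n -
      0) (int n + 0 + 1) -
      q ^ l * (qpoch (- q) q n * q ^ (n * (n + 1) div 2) * theta_fin q v (int n -
          c) (int n + c + 1)))
    has_sum K * (\<Sum>\<^sub>\<infinity>k. q powi (6 * k\<^sup>2 + u * k + 3 * k * (3 * k + 1) div 2)) -
        q ^ l * (K * (\<Sum>\<^sub>\<infinity>k. q powi e2 k))) UNIV"
    unfolding K_def by (intro has_sum_diff has_sum_cmult_right Bailey_theta_fin[OF q q0]) (simp_all add: e2_def)
  moreover have "K * (\<Sum>\<^sub>\<infinity>k. q powi (6 * k\<^sup>2 + u * k + 3 * k * (3 * k + 1) div 2)) -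
      q ^ l * (K * (\<Sum>\<^sub>\<infinity>k. q powi e2 k)) =
    K * ((\<Sum>\<^sub>\<infinity>k. q powi E k) - (\<Sum>\<^sub>\<infinity>k. q powi (int l + e2 k)))"
    unfolding 1 2 by (simp add: algebra_simps)
  moreover have "(\<Sum>\<^sub>\<infinity>k. q powi E k) - (\<Sum>\<^sub>\<infinity>k. q powi (int l + e2 k)) = theta_prod q a"
    unfolding theta_prod_def by (rule theta_quintuple[OF q q0 a E]) (use F in \<open>simp add: e2_def\<close>)
  ultimately have "((\<lambda>n. qpoch (- q) q n * q ^ (n * (n + 1) div 2) * theta_fin q u (int n -
      0) (int n + 0 + 1) -
      q ^ l * (qpoch (- q) q n * q ^ (n * (n + 1) div 2) * theta_fin q v (int n -
          c) (int n + c + 1)))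
    has_sum K * theta_prod q a) UNIV"
    by simp
  then show ?thesis
    unfolding pair[symmetric] K_def by (simp add: algebra_simps)
qed

text \<open>The numbers refer to Slater's list of identities of Rogers-Ramanujan type.\<close>

lemma Slater_81:
  "((\<lambda>n. qpoch (- q) q n * q ^ (n * (n + 1) div 2) * (q ^ (0 * n) / qpoch q q (2 * n)))
    has_sum qpoch_inf (- q) q / qpoch_inf q q * theta_prod q 1) UNIV"
proof (rule Bailey_pair_sum[where u = "- 1" and v = 5 and c = 0 and l = 1 and
      E = "\<lambda>k. 6 * (- k)\<^sup>2 + (- 1) * (- k) + 3 * (- k) * (3 * (- k) + 1) div 2"])
  show "theta_fin q (- 1) (int n) (int n + 1) - q ^ 1 * theta_fin q 5 (int n -
      0) (int n + 0 + 1) = q ^ (0 * n) / qpoch q q (2 * n)" for n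
    using theta_fin_even'[OF q q0, of n] inv_qpoch_int[of q "2 * n"] by simp
  show "2 * (6 * (- k)\<^sup>2 + (- 1) * (- k) + 3 * (- k) * (3 * (- k) + 1) div 2) =
      21 * k\<^sup>2 + (6 * int 1 - 7) * k" for k
    unfolding distrib_left[of 2] two_times_triangle_int
        by (simp add: power2_eq_square algebra_simps)
  show "2 * (int 1 + (6 * k\<^sup>2 + 5 * k + (3 * k + 0) * (3 * k + 0 + 1) div 2)) =
      21 * k\<^sup>2 + (6 * int 1 + 7) * k + 2 * int 1" for k
    unfolding distrib_left[of 2] two_times_triangle_int
        by (simp add: power2_eq_square algebra_simps)
qed auto

lemma Slater_80:
  "((\<lambda>n. qpoch (- q) q n * q ^ (n * (n + 1) div 2) * (q ^ (0 * n) / qpoch q q (2 * n + 1)))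
    has_sum qpoch_inf (- q) q / qpoch_inf q q * theta_prod q 2) UNIV"
proof (rule Bailey_pair_sum[where u = 1 and v = 5 and c = 1 and l = 1 and
      E = "\<lambda>k. 6 * k\<^sup>2 + 1 * k + 3 * k * (3 * k + 1) div 2"])
  show "theta_fin q 1 (int n) (int n + 1) - q ^ 1 * theta_fin q 5 (int n - 1) (int n + 1 + 1) =
      q ^ (0 * n) / qpoch q q (2 * n + 1)" for n
    using theta_fin_odd[OF q q0, of n] inv_qpoch_int[of q "2 * n + 1"] by (simp add: add.commute)
  show "2 * (6 * k\<^sup>2 + 1 * k + 3 * k * (3 * k + 1) div 2) = 21 * k\<^sup>2 + (6 * int 2 - 7) * k" for k
    unfolding distrib_left[of 2] two_times_triangle_int
        by (simp add: power2_eq_square algebra_simps)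
  show "2 * (int 1 + (6 * k\<^sup>2 + 5 * k + (3 * k + 1) * (3 * k + 1 + 1) div 2)) =
      21 * k\<^sup>2 + (6 * int 2 + 7) * k + 2 * int 2" for k
    unfolding distrib_left[of 2] two_times_triangle_int
        by (simp add: power2_eq_square algebra_simps)
qed auto

lemma Slater_82:
  "((\<lambda>n. qpoch (- q) q n * q ^ (n * (n + 1) div 2) * (q ^ (1 * n) / qpoch q q (2 * n + 1)))
    has_sum qpoch_inf (- q) q / qpoch_inf q q * theta_prod q 3) UNIV"
proof (rule Bailey_pair_sum[where u = 4 and v = 8 and c = 1 and l = 2 and
      E = "\<lambda>k. 6 * k\<^sup>2 + 4 * k + 3 * k * (3 * k + 1) div 2"])
  show "theta_fin q 4 (int n) (int n + 1) - q ^ 2 * theta_fin q 8 (int n - 1) (int n + 1 + 1) =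
      q ^ (1 * n) / qpoch q q (2 * n + 1)" for n
    using theta_fin_odd_power[OF q q0, of n] inv_qpoch_int[of q "2 * n + 1"]
        by (simp add: add.commute)
  show "2 * (6 * k\<^sup>2 + 4 * k + 3 * k * (3 * k + 1) div 2) = 21 * k\<^sup>2 + (6 * int 3 - 7) * k" for k
    unfolding distrib_left[of 2] two_times_triangle_int
        by (simp add: power2_eq_square algebra_simps)
  show "2 * (int 2 + (6 * k\<^sup>2 + 8 * k + (3 * k + 1) * (3 * k + 1 + 1) div 2)) =
      21 * k\<^sup>2 + (6 * int 3 + 7) * k + 2 * int 3" for k
    unfolding distrib_left[of 2] two_times_triangle_int
        by (simp add: power2_eq_square algebra_simps)
qed auto

end

text \<open>As \<open>0 powi 0\<close> is 1 and other powers of 0 vanish, only zeros of the exponent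
  matter. The linear bound excludes all pairs with i + j > 1, so just (1, 0) and (0, 1) need
  hypotheses.\<close>

lemma has_sum_double_at_0:
  assumes e: "\<And>i j. int i + int j - 1 \<le> e i j" and "e 0 0 = 0" "e 1 0 \<noteq> 0" "e 0 1 \<noteq> 0"
  shows "((\<lambda>(i, j). 0 powi e i j / (qpoch 0 0 (f i) * qpoch 0 0 (h j)))
      has_sum (1 :: complex)) (UNIV :: (nat \<times> nat) set)"
proof (rule has_sum_finite_neutralI[of "{(0, 0)}"])
  have q00: "qpoch 0 0 n = 1" for n
    by (simp add: qpoch_def)
  show "1 = (\<Sum>(i, j)\<in>{(0, 0)}. 0 powi e i j / (qpoch 0 0 (f i) * qpoch 0 0 (h j)))"
    using assms by (simp add: q00)
  fix p :: "nat \<times> nat" assume "p \<in> UNIV - {(0, 0)}"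
  then obtain i j where p: "p = (i, j)" "(i, j) \<noteq> (0, 0)"
    by (cases p) auto
  have "e i j \<noteq> 0"
  proof
    assume "e i j = 0"
    then have "int i + int j \<le> 1" using e[of i j] by simp
    with p have "(i = 1 \<and> j = 0) \<or> (i = 0 \<and> j = 1)" by auto
    then show False using assms \<open>e i j = 0\<close> by auto
  qed
  then show "(case p of (i, j) \<Rightarrow> 0 powi e i j / (qpoch 0 0 (f i) * qpoch 0 0 (h j))) =
      (0 :: complex)"
    by (simp add: p)
qed auto

theorem theorem5p9:
  fixes q :: complex
  assumes "norm q < 1"
  shows "((\<lambda>(i, j). q powi ((int i)^2 - 2 * int i * int j + 2 * (int j)^2 + int i - int j)
            / (qpoch q q (2 * i) * qpoch q q (2 * j)))
          has_sum
          1 / ((qpoch_inf q (q^2))^2 * qpoch_infs [q^2, q^3, q^4, q^10, q^11, q^12] (q^14)))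
         (UNIV :: (nat \<times> nat) set)
      \<and> ((\<lambda>(i, j). q powi ((int i)^2 - 2 * int i * int j + 2 * (int j)^2 + int j)
            / (qpoch q q (2 * i) * qpoch q q (2 * j + 1)))
          has_sum
          1 / ((qpoch_inf q (q^2))^2 * qpoch_infs [q^2, q^3, q^4, q^10, q^11, q^12] (q^14)))
         (UNIV :: (nat \<times> nat) set)
      \<and> ((\<lambda>(i, j). q powi ((int i)^2 - 2 * int i * int j + 2 * (int j)^2 + int i - int j)
            / (qpoch q q (2 * i + 1) * qpoch q q (2 * j)))
          has_sum
          1 / ((qpoch_inf q (q^2))^2 * qpoch_infs [q, q^4, q^6, q^8, q^10, q^13] (q^14)))
         (UNIV :: (nat \<times> nat) set)
      \<and> ((\<lambda>(i, j). q powi ((int i)^2 - 2 * int i * int j + 2 * (int j)^2 + int j)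
            / (qpoch q q (2 * i + 1) * qpoch q q (2 * j + 1)))
          has_sum
          1 / ((qpoch_inf q (q^2))^2 * qpoch_infs [q, q^4, q^6, q^8, q^10, q^13] (q^14)))
         (UNIV :: (nat \<times> nat) set)
      \<and> ((\<lambda>(i, j). q powi ((int i)^2 - 2 * int i * int j + 2 * (int j)^2 + 2 * int i - int j)
            / (qpoch q q (2 * i + 1) * qpoch q q (2 * j)))
          has_sum
          1 / ((qpoch_inf q (q^2))^2 * qpoch_infs [q^2, q^5, q^6, q^8, q^9, q^12] (q^14)))
         (UNIV :: (nat \<times> nat) set)
      \<and> ((\<lambda>(i, j). q powi ((int i)^2 - 2 * int i * int j + 2 * (int j)^2 + int i + int j)
            / (qpoch q q (2 * i + 1) * qpoch q q (2 * j + 1)))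
          has_sum
          1 / ((qpoch_inf q (q^2))^2 * qpoch_infs [q^2, q^5, q^6, q^8, q^9, q^12] (q^14)))
         (UNIV :: (nat \<times> nat) set)"
proof (cases "q = 0")
  case True
  have q00: "qpoch_inf 0 0 = 1"
    by (simp add: qpoch_inf_def)
  have b: "int i + int j - 1 \<le> (int i)\<^sup>2 - 2 * int i * int j + 2 * (int j)\<^sup>2 + int i - int j"
    "int i + int j - 1 \<le> (int i)\<^sup>2 - 2 * int i * int j + 2 * (int j)\<^sup>2 + int j"
    "int i + int j - 1 \<le> (int i)\<^sup>2 - 2 * int i * int j + 2 * (int j)\<^sup>2 + 2 * int i - int j"
    "int i + int j - 1 \<le> (int i)\<^sup>2 - 2 * int i * int j + 2 * (int j)\<^sup>2 + int i + int j" for i j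
    using exponent_bounds[of i j 0] exponent_bounds[of i j 1] by simp_all
  show ?thesis
    using b by (auto simp: True q00 qpoch_infs_def intro!: has_sum_double_at_0)
next
  case False
  \<comment> \<open>Each single sum yields two conjuncts: s = 0 with denominators of index 2i, then
    s = 0 and s = 1 with index 2i + 1.\<close>
  note p = double_has_sum_parity[OF assms False]
  from p[OF Slater_81[OF assms False]] p[OF Slater_80[OF assms False]] p[OF Slater_82[OF assms False]]
  show ?thesis
    unfolding theta_prod_eq[OF assms, THEN product_side[OF assms]] by simp
qed

end
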